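(* Let $d^{**}$ denote the critical dimension for the biharmonic Alt-Caffarelli problem, i.e. the smallest dimension $d\ge 1$ such that there exists a function $z:\mathbb{R}^{d}\to\mathbb{R}$ such that (i) $z$ is nontrivial and two-homogeneous, (ii) $z$ is a global minimizer of $\mathcal{F}$, and (iii) the free boundary $\partial\{z=0,\nabla z=0\}$ is not a $(d-1)$-dimensional $C^1$-submanifold of $\mathbb{R}^{d}$. Then $d^{**}=2$.
   Context: For $\Omega\subset\mathbb{R}^n$ open and bounded and $u\in H^2(\Omega)$, the two-sided biharmonic Alt-Caffarelli functional is $\mathcal{F}(u,\Omega):=\int_\Omega(\Delta u)^2\,\mathrm{d}x+|\{x\in\Omega:u(x)\neq 0\}|$, where $|\cdot|$ is Lebesgue measure. A function $u\in H^2_{loc}(\mathbb{R}^n)$ is a global minimizer of $\mathcal{F}$ if for all bounded open sets $\Omega\subset\mathbb{R}^n$ and all $v\in H^2(\Omega)$ with $v-u\in H^2_0(\Omega)$ one has $\mathcal{F}(u,\Omega)\le\mathcal{F}(v,\Omega)$. Here $H^2_0(\Omega)$ is the closure of $C_0^\infty(\Omega)$ in $H^2(\Omega)$. Global minimizers are known to have a $C^1$ representative, which is the one used in (iii). "Two-homogeneous" means positively homogeneous of degree two: $z(tx)=t^2z(x)$ for all $t>0$ and all $x$. "Nontrivial" means not identically zero. The set $\{z=0,\nabla z=0\}$ is $\{x: z(x)=0 \text{ and } \nabla z(x)=0\}$, and $\partial$ denotes its topological boundary. *)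

theory Defs
  imports "HOL-Analysis.Analysis"
begin

text \<open>
  The dimension \<open>d\<close> is a bound variable of the problem, so \<open>\<real>\<^sup>d\<close> is not a type here but the
  library space \<^term>\<open>Euclidean_space d\<close>, i.e. the sequences \<^typ>\<open>nat \<Rightarrow> real\<close> that vanish from index
  \<open>d\<close> on, with coordinates \<open>x 0, \<dots>, x (d - 1)\<close>. Functions on \<open>\<real>\<^sup>d\<close> are HOL functions on
  \<^typ>\<open>nat \<Rightarrow> real\<close>; their values off \<^term>\<open>topspace (Euclidean_space d)\<close> are never used.
\<close>

abbreviation Rn :: "nat \<Rightarrow> (nat \<Rightarrow> real) set" where
  "Rn d \<equiv> topspace (Euclidean_space d)"

text \<open>Lebesgue measure on \<open>\<real>\<^sup>d\<close>: the completion of the \<open>d\<close>-fold product of \<^term>\<open>lborel\<close>,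
  transported to \<^term>\<open>Rn d\<close> by padding with zeros.\<close>

definition leb :: "nat \<Rightarrow> (nat \<Rightarrow> real) measure" where
  "leb d = completion
     (distr (\<Pi>\<^sub>M i\<in>{..<d}. lborel) (restrict_space borel (Rn d))
       (\<lambda>x i. if i < d then x i else 0))"

definition bounded_in_Rn :: "nat \<Rightarrow> (nat \<Rightarrow> real) set \<Rightarrow> bool" where
  "bounded_in_Rn d S \<longleftrightarrow> S \<subseteq> Rn d \<and> (\<exists>B. \<forall>x\<in>S. sqrt (\<Sum>i<d. (x i)\<^sup>2) \<le> B)"

subsection \<open>Classical derivatives\<close>

definition partial :: "nat \<Rightarrow> ((nat \<Rightarrow> real) \<Rightarrow> real) \<Rightarrow> (nat \<Rightarrow> real) \<Rightarrow> real" where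
  "partial i f x = deriv (\<lambda>t. f (x(i := t))) (x i)"

text \<open>Higher derivatives are indexed by lists of coordinate directions;
  \<open>partials [i, j] f\<close> is \<open>\<partial>\<^sub>i \<partial>\<^sub>j f\<close>.\<close>

definition partials :: "nat list \<Rightarrow> ((nat \<Rightarrow> real) \<Rightarrow> real) \<Rightarrow> (nat \<Rightarrow> real) \<Rightarrow> real" where
  "partials \<alpha> f = foldr partial \<alpha> f"

text \<open>\<open>C\<^sup>k\<close> on an open set \<open>U\<close> of \<open>\<real>\<^sup>d\<close>.\<close>

primrec Ck_on :: "nat \<Rightarrow> nat \<Rightarrow> (nat \<Rightarrow> real) set \<Rightarrow> ((nat \<Rightarrow> real) \<Rightarrow> real) \<Rightarrow> bool" where
  "Ck_on d 0 U f \<longleftrightarrow> continuous_map (subtopology (Euclidean_space d) U) euclideanreal f"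
| "Ck_on d (Suc k) U f \<longleftrightarrow>
     continuous_map (subtopology (Euclidean_space d) U) euclideanreal f \<and>
     (\<forall>i<d. (\<forall>x\<in>U. (\<lambda>t. f (x(i := t))) differentiable (at (x i))) \<and> Ck_on d k U (partial i f))"

text \<open>\<open>C\<^sub>0\<^sup>\<infinity>(\<Omega>)\<close>, its elements being extended by zero to \<open>\<real>\<^sup>d\<close>.\<close>

definition test_functions :: "nat \<Rightarrow> (nat \<Rightarrow> real) set \<Rightarrow> ((nat \<Rightarrow> real) \<Rightarrow> real) set" where
  "test_functions d \<Omega> = {\<phi>. (\<forall>k. Ck_on d k (Rn d) \<phi>) \<and>
     (\<exists>K. compactin (Euclidean_space d) K \<and> K \<subseteq> \<Omega> \<and> (\<forall>x\<in>Rn d - K. \<phi> x = 0))}"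

subsection \<open>Weak derivatives and Sobolev spaces\<close>

definition L1_loc :: "nat \<Rightarrow> (nat \<Rightarrow> real) set \<Rightarrow> ((nat \<Rightarrow> real) \<Rightarrow> real) set" where
  "L1_loc d \<Omega> = {u. \<forall>K. compactin (Euclidean_space d) K \<and> K \<subseteq> \<Omega> \<longrightarrow> set_integrable (leb d) K u}"

definition L2 :: "nat \<Rightarrow> (nat \<Rightarrow> real) set \<Rightarrow> ((nat \<Rightarrow> real) \<Rightarrow> real) set" where
  "L2 d \<Omega> = {u. set_borel_measurable (leb d) \<Omega> u \<and> set_integrable (leb d) \<Omega> (\<lambda>x. (u x)\<^sup>2)}"

definition has_weak_deriv ::
  "nat \<Rightarrow> (nat \<Rightarrow> real) set \<Rightarrow> nat list \<Rightarrow> ((nat \<Rightarrow> real) \<Rightarrow> real) \<Rightarrow> ((nat \<Rightarrow> real) \<Rightarrow> real) \<Rightarrow> bool" where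
  "has_weak_deriv d \<Omega> \<alpha> u g \<longleftrightarrow> u \<in> L1_loc d \<Omega> \<and> g \<in> L1_loc d \<Omega> \<and>
     (\<forall>\<phi>\<in>test_functions d \<Omega>.
        (LINT x:\<Omega>|leb d. u x * partials \<alpha> \<phi> x) =
        (- 1) ^ length \<alpha> * (LINT x:\<Omega>|leb d. g x * \<phi> x))"

text \<open>Weak derivatives are unique almost everywhere, so any representative may be chosen.\<close>

definition weak_deriv ::
  "nat \<Rightarrow> (nat \<Rightarrow> real) set \<Rightarrow> nat list \<Rightarrow> ((nat \<Rightarrow> real) \<Rightarrow> real) \<Rightarrow> (nat \<Rightarrow> real) \<Rightarrow> real" where
  "weak_deriv d \<Omega> \<alpha> u = (SOME g. has_weak_deriv d \<Omega> \<alpha> u g)"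

definition weak_laplacian ::
  "nat \<Rightarrow> (nat \<Rightarrow> real) set \<Rightarrow> ((nat \<Rightarrow> real) \<Rightarrow> real) \<Rightarrow> (nat \<Rightarrow> real) \<Rightarrow> real" where
  "weak_laplacian d \<Omega> u x = (\<Sum>i<d. weak_deriv d \<Omega> [i, i] u x)"

definition multi_indices :: "nat \<Rightarrow> nat \<Rightarrow> nat list set" where
  "multi_indices d k = {\<alpha>. set \<alpha> \<subseteq> {..<d} \<and> length \<alpha> \<le> k}"

definition H2 :: "nat \<Rightarrow> (nat \<Rightarrow> real) set \<Rightarrow> ((nat \<Rightarrow> real) \<Rightarrow> real) set" where
  "H2 d \<Omega> = {u \<in> L2 d \<Omega>. \<forall>\<alpha>\<in>multi_indices d 2. \<exists>g\<in>L2 d \<Omega>. has_weak_deriv d \<Omega> \<alpha> u g}"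

definition H2_norm :: "nat \<Rightarrow> (nat \<Rightarrow> real) set \<Rightarrow> ((nat \<Rightarrow> real) \<Rightarrow> real) \<Rightarrow> real" where
  "H2_norm d \<Omega> u =
     sqrt (\<Sum>\<alpha>\<in>multi_indices d 2. (LINT x:\<Omega>|leb d. (weak_deriv d \<Omega> \<alpha> u x)\<^sup>2))"

definition H2_0 :: "nat \<Rightarrow> (nat \<Rightarrow> real) set \<Rightarrow> ((nat \<Rightarrow> real) \<Rightarrow> real) set" where
  "H2_0 d \<Omega> = {w \<in> H2 d \<Omega>. \<exists>\<phi>. (\<forall>n::nat. \<phi> n \<in> test_functions d \<Omega>) \<and>
     (\<lambda>n. H2_norm d \<Omega> (\<lambda>x. w x - \<phi> n x)) \<longlonglongrightarrow> 0}"

definition H2_loc :: "nat \<Rightarrow> ((nat \<Rightarrow> real) \<Rightarrow> real) set" where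
  "H2_loc d = {u. \<forall>\<Omega>. openin (Euclidean_space d) \<Omega> \<and> bounded_in_Rn d \<Omega> \<longrightarrow> u \<in> H2 d \<Omega>}"

subsection \<open>The biharmonic Alt-Caffarelli functional\<close>

definition AC_functional :: "nat \<Rightarrow> ((nat \<Rightarrow> real) \<Rightarrow> real) \<Rightarrow> (nat \<Rightarrow> real) set \<Rightarrow> real" where
  "AC_functional d u \<Omega> =
     (LINT x:\<Omega>|leb d. (weak_laplacian d \<Omega> u x)\<^sup>2) + measure (leb d) {x \<in> \<Omega>. u x \<noteq> 0}"

definition global_minimizer :: "nat \<Rightarrow> ((nat \<Rightarrow> real) \<Rightarrow> real) \<Rightarrow> bool" where
  "global_minimizer d u \<longleftrightarrow> u \<in> H2_loc d \<and>
     (\<forall>\<Omega> v. openin (Euclidean_space d) \<Omega> \<and> bounded_in_Rn d \<Omega> \<and>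
        v \<in> H2 d \<Omega> \<and> (\<lambda>x. v x - u x) \<in> H2_0 d \<Omega> \<longrightarrow>
        AC_functional d u \<Omega> \<le> AC_functional d v \<Omega>)"

subsection \<open>Free boundary, submanifolds, critical dimension\<close>

definition C1_representative ::
  "nat \<Rightarrow> ((nat \<Rightarrow> real) \<Rightarrow> real) \<Rightarrow> ((nat \<Rightarrow> real) \<Rightarrow> real) \<Rightarrow> bool" where
  "C1_representative d u u' \<longleftrightarrow> Ck_on d 1 (Rn d) u' \<and> (AE x in leb d. u' x = u x)"

definition free_boundary :: "nat \<Rightarrow> ((nat \<Rightarrow> real) \<Rightarrow> real) \<Rightarrow> (nat \<Rightarrow> real) set" where
  "free_boundary d u =
     Euclidean_space d frontier_of {x \<in> Rn d. u x = 0 \<and> (\<forall>i<d. partial i u x = 0)}"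

definition C1_diffeo ::
  "nat \<Rightarrow> (nat \<Rightarrow> real) set \<Rightarrow> (nat \<Rightarrow> real) set \<Rightarrow> ((nat \<Rightarrow> real) \<Rightarrow> (nat \<Rightarrow> real)) \<Rightarrow> bool" where
  "C1_diffeo d U V \<Phi> \<longleftrightarrow>
     openin (Euclidean_space d) U \<and> openin (Euclidean_space d) V \<and> bij_betw \<Phi> U V \<and>
     (\<forall>j<d. Ck_on d 1 U (\<lambda>x. \<Phi> x j)) \<and> (\<forall>j<d. Ck_on d 1 V (\<lambda>y. inv_into U \<Phi> y j))"

text \<open>Local straightening; note that \<open>Rn k\<close> is \<open>\<real>\<^sup>k \<times> {0}\<close> inside \<open>Rn d\<close>.\<close>

definition C1_submanifold :: "nat \<Rightarrow> nat \<Rightarrow> (nat \<Rightarrow> real) set \<Rightarrow> bool" where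
  "C1_submanifold d k S \<longleftrightarrow> S \<subseteq> Rn d \<and>
     (\<forall>p\<in>S. \<exists>U V \<Phi>. p \<in> U \<and> C1_diffeo d U V \<Phi> \<and> \<Phi> ` (S \<inter> U) = V \<inter> Rn k)"

definition two_homogeneous :: "nat \<Rightarrow> ((nat \<Rightarrow> real) \<Rightarrow> real) \<Rightarrow> bool" where
  "two_homogeneous d z \<longleftrightarrow> (\<forall>x\<in>Rn d. \<forall>t>0. z (\<lambda>i. t * x i) = t\<^sup>2 * z x)"

text \<open>Weak derivatives only see \<open>z\<close> up to null sets; the free boundary is that of its (unique)
  \<open>C\<^sup>1\<close> representative \<open>z'\<close>.\<close>

definition has_singular_minimizer :: "nat \<Rightarrow> bool" where
  "has_singular_minimizer d \<longleftrightarrow>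
     (\<exists>z. (\<exists>x\<in>Rn d. z x \<noteq> 0) \<and> two_homogeneous d z \<and>
          global_minimizer d z \<and>
          (\<exists>z'. C1_representative d z z' \<and> \<not> C1_submanifold d (d - 1) (free_boundary d z')))"

definition critical_dimension :: nat where
  "critical_dimension = (LEAST d. d \<ge> 1 \<and> has_singular_minimizer d)"

end

theory Submission
  imports Defs
begin

text \<open>
  Dimension two, and in fact every \<open>d \<ge> 2\<close>, is singular because of the paraboloid
  \<open>u x = |x|\<^sup>2 / (2 d)\<close>. It is two-homogeneous, and \<open>u\<close> and its gradient vanish together only at the
  origin, so its free boundary is a point, which is not a hypersurface unless \<open>d = 1\<close>.

  That \<open>u\<close> minimizes is seen as follows. Its Laplacian is constantly \<open>1\<close>, so \<open>u\<close> has energy at most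
  \<open>2 |\<Omega>|\<close> on a bounded open set \<open>\<Omega>\<close>. Let \<open>v = u + w\<close> with \<open>w \<in> H\<^sup>2\<^sub>0(\<Omega>)\<close> be a competitor and put
  \<open>h = \<Delta>v\<close>. The integral of \<open>\<Delta>w\<close> vanishes, so \<open>h\<close> has integral \<open>|\<Omega>|\<close>; and \<open>h = 0\<close> almost everywhere
  on \<open>Z = {v = 0}\<close>, since the weak derivatives of a Sobolev function vanish almost everywhere on its
  zero set, and this can be used twice. Hence
  \<open>|Z| \<le> \<integral> (h - 1)\<^sup>2 = \<integral> h\<^sup>2 - |\<Omega>|\<close>, which says that the energy \<open>\<integral> h\<^sup>2 + |\<Omega>| - |Z|\<close> of \<open>v\<close> is at least
  \<open>2 |\<Omega>|\<close>. These two halves are \<open>AC_functional_paraboloid\<close> and \<open>AC_functional_competitor\<close>.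

  The analytic core is \<open>derivative_zero_on_zero_set\<close>. As \<open>w\<close> is by definition a limit of test
  functions, one can integrate by parts classically with \<open>arctan (m f\<^sub>n) / m\<close> for smooth approximations
  \<open>f\<^sub>n\<close>. Letting first \<open>n\<close> and then \<open>m\<close> tend to infinity shows that the derivative, cut off to the zero
  set, is orthogonal to all test functions, so it vanishes by \<open>fundamental_lemma\<close>. The same fundamental lemma gives the
  uniqueness of weak derivatives, which identifies the arbitrarily chosen representatives in the
  functional and in the Sobolev norm.

  Dimension one is regular for a simple reason: a two-homogeneous function on the line is
  \<open>a s\<^sup>2\<close> on one side of the origin and \<open>b s\<^sup>2\<close> on the other. If it is nontrivial, the set where it
  vanishes to first order is the origin or a closed half-line from the origin, with boundary \<open>{0}\<close>
  in each case (\<open>free_boundary_dimension_1\<close>), and a point is a zero-dimensional submanifold.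
\<close>

section \<open>Euclidean space and Lebesgue measure in coordinates\<close>

lemma Rn_iff: "x \<in> Rn d \<longleftrightarrow> (\<forall>i\<ge>d. x i = 0)"
  by (simp add: topspace_Euclidean_space)

lemma Euclidean_space_eq: "Euclidean_space d = top_of_set (Rn d)"
  by (simp add: topspace_Euclidean_space Euclidean_space_def euclidean_product_topology)

lemma fun_upd_Rn: "x \<in> Rn d \<Longrightarrow> i < d \<Longrightarrow> x(i := t) \<in> Rn d"
  by (auto simp: Rn_iff)

lemma continuous_fun_upd: "continuous_on UNIV (\<lambda>t::real. (x::nat \<Rightarrow> real)(i := t))"
proof (rule continuous_on_coordinatewise_then_product)
  fix j show "continuous_on UNIV (\<lambda>t. (x(i := t)) j)"
    by (cases "j = i") (auto intro: continuous_intros)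
qed

lemma openin_Euclidean: "openin (Euclidean_space d) U \<longleftrightarrow> (\<exists>T. open T \<and> U = Rn d \<inter> T)"
  by (subst Euclidean_space_eq) (rule openin_open)

lemma compactin_Euclidean: "compactin (Euclidean_space d) K \<longleftrightarrow> compact K \<and> K \<subseteq> Rn d"
  by (subst Euclidean_space_eq) (auto simp: compactin_subtopology)

lemma Ck_on_0: "U \<subseteq> Rn d \<Longrightarrow> Ck_on d 0 U f \<longleftrightarrow> continuous_on U f"
  unfolding Ck_on.simps
  by (subst Euclidean_space_eq) (simp add: subtopology_subtopology Int_absorb1)

definition pad :: "nat \<Rightarrow> (nat \<Rightarrow> real) \<Rightarrow> nat \<Rightarrow> real" where
  "pad d x = (\<lambda>i. if i < d then x i else 0)"

abbreviation lborel_prod :: "nat \<Rightarrow> (nat \<Rightarrow> real) measure" where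
  "lborel_prod d \<equiv> \<Pi>\<^sub>M i\<in>{..<d}. lborel"

abbreviation borel_Rn :: "nat \<Rightarrow> (nat \<Rightarrow> real) measure" where
  "borel_Rn d \<equiv> restrict_space borel (Rn d)"

lemma pad_in_Rn: "pad d x \<in> Rn d"
  by (simp add: Rn_iff pad_def)

lemma measurable_pad: "pad d \<in> lborel_prod d \<rightarrow>\<^sub>M borel_Rn d"
proof (rule measurable_restrict_space2)
  show "pad d \<in> space (lborel_prod d) \<rightarrow> Rn d"
    using pad_in_Rn by auto
  show "pad d \<in> borel_measurable (lborel_prod d)"
  proof (rule measurable_coordinatewise_then_product)
    fix i show "(\<lambda>x. pad d x i) \<in> borel_measurable (lborel_prod d)"
      by (cases "i < d") (auto simp: pad_def)
  qed
qed

interpretation lborel_product: product_sigma_finite "\<lambda>_::nat. lborel :: real measure"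
  by standard

text \<open>Lebesgue measure before completion. Almost everywhere statements do not distinguish the two, and
  Borel functions have the same integrals.\<close>

definition leb_borel :: "nat \<Rightarrow> (nat \<Rightarrow> real) measure" where
  "leb_borel d = distr (lborel_prod d) (borel_Rn d) (pad d)"

lemma leb_eq: "leb d = completion (leb_borel d)"
  unfolding leb_def leb_borel_def pad_def ..

lemma sets_leb_borel [simp, measurable_cong]: "sets (leb_borel d) = sets (borel_Rn d)"
  by (simp add: leb_borel_def)

lemma space_leb_borel [simp]: "space (leb_borel d) = Rn d"
  by (simp add: leb_borel_def space_restrict_space)

lemma space_leb: "space (leb d) = Rn d"
  by (simp add: leb_eq)

lemma AE_leb_iff: "(AE x in leb d. P x) \<longleftrightarrow> (AE x in leb_borel d. P x)"
  unfolding leb_eq by (rule AE_completion_iff)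

lemma borel_measurable_lebI: "f \<in> borel_measurable (borel_Rn d) \<Longrightarrow> f \<in> borel_measurable (leb d)"
  unfolding leb_eq by (rule measurable_completion) (simp cong: measurable_cong_sets)

lemma sets_lebI: "A \<in> sets (borel_Rn d) \<Longrightarrow> A \<in> sets (leb d)"
  unfolding leb_eq by (rule sets_completionI_sets) simp

lemma integral_leb:
  fixes f :: "_ \<Rightarrow> real"
  assumes "f \<in> borel_measurable (borel_Rn d)"
  shows "integral\<^sup>L (leb d) f = (\<integral>x. f (pad d x) \<partial>lborel_prod d)"
proof -
  have "f \<in> borel_measurable (leb_borel d)"
    using assms by (simp cong: measurable_cong_sets)
  then have "integral\<^sup>L (leb d) f = integral\<^sup>L (leb_borel d) f"
    unfolding leb_eq by (rule integral_completion)
  also have "\<dots> = (\<integral>x. f (pad d x) \<partial>lborel_prod d)"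
    unfolding leb_borel_def by (rule integral_distr[OF measurable_pad assms])
  finally show ?thesis .
qed

lemma integrable_leb_iff:
  fixes f :: "_ \<Rightarrow> real"
  assumes "f \<in> borel_measurable (borel_Rn d)"
  shows "integrable (leb d) f \<longleftrightarrow> integrable (lborel_prod d) (\<lambda>x. f (pad d x))"
proof -
  have "f \<in> borel_measurable (leb_borel d)"
    using assms by (simp cong: measurable_cong_sets)
  then have "integrable (leb d) f \<longleftrightarrow> integrable (leb_borel d) f"
    unfolding leb_eq by (rule integrable_completion)
  also have "\<dots> \<longleftrightarrow> integrable (lborel_prod d) (\<lambda>x. f (pad d x))"
    unfolding leb_borel_def by (rule integrable_distr_eq[OF measurable_pad assms])
  finally show ?thesis .
qed

lemma openin_in_sets_leb:
  assumes "openin (Euclidean_space d) U" shows "U \<in> sets (leb d)"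
proof (rule sets_lebI)
  obtain T where "open T" "U = Rn d \<inter> T"
    using assms unfolding openin_Euclidean by auto
  then show "U \<in> sets (borel_Rn d)"
    by (auto simp: sets_restrict_space)
qed

lemma compact_in_sets_leb:
  assumes "compact K" "K \<subseteq> Rn d" shows "K \<in> sets (leb d)"
proof (rule sets_lebI)
  have "K = Rn d \<inter> K" using assms by auto
  then show "K \<in> sets (borel_Rn d)"
    using assms(1)[THEN compact_imp_closed, THEN borel_closed] unfolding sets_restrict_space by blast
qed

lemma continuous_borel_measurable_Rn:
  "continuous_on (Rn d) f \<Longrightarrow> f \<in> borel_measurable (borel_Rn d)"
  by (rule borel_measurable_continuous_on_restrict)

definition cube :: "nat \<Rightarrow> (nat \<Rightarrow> real) \<Rightarrow> (nat \<Rightarrow> real) \<Rightarrow> (nat \<Rightarrow> real) set" where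
  "cube d a b = {x \<in> Rn d. \<forall>i<d. a i < x i \<and> x i < b i}"

definition closed_cube :: "nat \<Rightarrow> (nat \<Rightarrow> real) \<Rightarrow> (nat \<Rightarrow> real) \<Rightarrow> (nat \<Rightarrow> real) set" where
  "closed_cube d a b = {x \<in> Rn d. \<forall>i<d. a i \<le> x i \<and> x i \<le> b i}"

lemma cube_in_borel_Rn: "cube d a b \<in> sets (borel_Rn d)"
proof -
  have "open (\<Inter>i\<in>{..<d}. {x::nat \<Rightarrow> real. a i < x i} \<inter> {x. x i < b i})"
    by (intro open_INT finite_lessThan ballI open_Int open_Collect_less continuous_on_product_coordinates continuous_on_const) 
  moreover have "cube d a b = Rn d \<inter> (\<Inter>i\<in>{..<d}. {x. a i < x i} \<inter> {x. x i < b i})"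
    unfolding cube_def by blast
  ultimately show ?thesis
    unfolding sets_restrict_space using borel_open by blast
qed

lemma compact_closed_cube: "compact (closed_cube d a b)"
proof -
  have "compactin (powertop_real UNIV) (\<Pi>\<^sub>E i\<in>UNIV. if i < d then {a i..b i} else {0})"
    unfolding compactin_PiE by (intro disjI2 ballI) (simp add: compactin_euclidean_iff)
  moreover have "(\<Pi>\<^sub>E i\<in>UNIV. if i < d then {a i..b i} else {0}) = closed_cube d a b"
  proof (intro set_eqI iffI)
    fix x assume x: "x \<in> (\<Pi>\<^sub>E i\<in>UNIV. if i < d then {a i..b i} else {0})"
    have "x i \<in> {a i..b i}" if "i < d" for i
      using PiE_mem[OF x, of i] that by simp
    moreover have "x i = 0" if "d \<le> i" for i
      using PiE_mem[OF x, of i] that by simp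
    ultimately show "x \<in> closed_cube d a b"
      unfolding closed_cube_def Rn_iff by auto
  next
    fix x assume "x \<in> closed_cube d a b"
    then show "x \<in> (\<Pi>\<^sub>E i\<in>UNIV. if i < d then {a i..b i} else {0})"
      by (simp add: closed_cube_def Rn_iff PiE_UNIV_domain)
  qed
  ultimately show ?thesis by (simp only: euclidean_product_topology compactin_euclidean_iff)
qed

lemma emeasure_leb_cube:
  assumes "\<And>i. i < d \<Longrightarrow> a i \<le> b i"
  shows "emeasure (leb d) (cube d a b) = ennreal (\<Prod>i<d. b i - a i)"
proof -
  have "emeasure (leb d) (cube d a b) = emeasure (leb_borel d) (cube d a b)"
    unfolding leb_eq using cube_in_borel_Rn by simp
  also have "\<dots> = emeasure (lborel_prod d) (pad d -` cube d a b \<inter> space (lborel_prod d))"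
    unfolding leb_borel_def by (rule emeasure_distr[OF measurable_pad cube_in_borel_Rn])
  also have "pad d -` cube d a b \<inter> space (lborel_prod d) = (\<Pi>\<^sub>E i\<in>{..<d}. {a i<..<b i})"
    using pad_in_Rn by (auto simp: cube_def space_PiM PiE_def Pi_def) (auto simp: pad_def)
  also have "emeasure (lborel_prod d) \<dots> = (\<Prod>i<d. emeasure lborel {a i<..<b i})"
    by (rule lborel_product.emeasure_PiM) auto
  also have "\<dots> = (\<Prod>i<d. ennreal (b i - a i))"
    by (rule prod.cong) (use assms in auto)
  also have "\<dots> = ennreal (\<Prod>i<d. b i - a i)"
    by (rule prod_ennreal) (use assms in auto)
  finally show ?thesis .
qed

lemma emeasure_leb_finite:
  assumes "\<And>x i. x \<in> S \<Longrightarrow> i < d \<Longrightarrow> \<bar>x i\<bar> \<le> B" "S \<subseteq> Rn d"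
  shows "emeasure (leb d) S < \<infinity>"
proof -
  have "emeasure (leb d) S \<le> emeasure (leb d) (cube d (\<lambda>_. -\<bar>B\<bar>-1) (\<lambda>_. \<bar>B\<bar>+1))"
  proof (rule emeasure_mono)
    show "S \<subseteq> cube d (\<lambda>_. -\<bar>B\<bar>-1) (\<lambda>_. \<bar>B\<bar>+1)"
    proof
      fix x assume "x \<in> S"
      then have "x \<in> Rn d" "\<And>i. i < d \<Longrightarrow> \<bar>x i\<bar> \<le> B" using assms by auto
      then show "x \<in> cube d (\<lambda>_. -\<bar>B\<bar>-1) (\<lambda>_. \<bar>B\<bar>+1)"
        by (force simp: cube_def)
    qed
  qed (rule sets_lebI[OF cube_in_borel_Rn])
  also have "\<dots> < \<infinity>"
    by (subst emeasure_leb_cube) auto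
  finally show ?thesis .
qed

lemma bounded_in_Rn_coordinates:
  assumes "bounded_in_Rn d S" shows "\<exists>B. \<forall>x\<in>S. \<forall>i<d. \<bar>x i\<bar> \<le> B"
proof -
  obtain B where B: "\<And>x. x \<in> S \<Longrightarrow> sqrt (\<Sum>i<d. (x i)\<^sup>2) \<le> B"
    using assms by (auto simp: bounded_in_Rn_def)
  have "\<bar>x i\<bar> \<le> B" if "x \<in> S" "i < d" for x i
  proof -
    have "(x i)\<^sup>2 \<le> (\<Sum>i<d. (x i)\<^sup>2)"
      using that(2) by (intro member_le_sum) auto
    then have "\<bar>x i\<bar> \<le> sqrt (\<Sum>i<d. (x i)\<^sup>2)"
      by (metis real_sqrt_abs real_sqrt_le_iff)
    then show ?thesis using B[OF that(1)] by linarith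
  qed
  then show ?thesis by blast
qed

lemma compact_coordinates_bounded:
  fixes K :: "(nat \<Rightarrow> real) set"
  assumes "compact K" shows "\<exists>B>0. \<forall>x\<in>K. \<forall>i<d. \<bar>x i\<bar> < B"
proof -
  have "\<exists>B. \<forall>x\<in>K. \<bar>x i\<bar> \<le> B" for i
  proof -
    have "compact ((\<lambda>x. x i) ` K)"
      by (intro compact_continuous_image assms continuous_on_subset[OF continuous_on_product_coordinates]) auto
    then obtain B where "\<forall>y\<in>(\<lambda>x. x i) ` K. norm y \<le> B"
      using compact_imp_bounded bounded_iff by blast
    then show ?thesis by auto
  qed
  then obtain B where B: "\<And>i x. x \<in> K \<Longrightarrow> \<bar>x i\<bar> \<le> B i" by metis
  have "\<bar>x i\<bar> < (\<Sum>i<d. \<bar>B i\<bar>) + 1" if "x \<in> K" "i < d" for x i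
  proof -
    have "\<bar>B i\<bar> \<le> (\<Sum>i<d. \<bar>B i\<bar>)"
      using that(2) by (intro member_le_sum) auto
    then show ?thesis using B[OF that(1), of i] by linarith
  qed
  moreover have "(\<Sum>i<d. \<bar>B i\<bar>) + 1 > 0"
    using sum_nonneg[of "{..<d}" "\<lambda>i. \<bar>B i\<bar>"] by (simp add: add_nonneg_pos)
  ultimately show ?thesis by blast
qed

lemma emeasure_leb_compact:
  assumes "compact K" "K \<subseteq> Rn d" shows "emeasure (leb d) K < \<infinity>"
proof -
  obtain B where B: "\<And>x i. x \<in> K \<Longrightarrow> i < d \<Longrightarrow> \<bar>x i\<bar> < B"
    using compact_coordinates_bounded[OF assms(1), of d] by auto
  show ?thesis
    by (rule emeasure_leb_finite[where B = B]) (use B assms(2) in \<open>auto intro: less_imp_le\<close>)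
qed

text \<open>Rational corners leave only countably many cubes, so an open set is a countable union of them.
  The corners are extensional functions because only their first \<open>d\<close> values matter.\<close>

lemma rational_cube_in_open:
  assumes "openin (Euclidean_space d) U" "x \<in> U"
  obtains p q where "x \<in> cube d p q" "closed_cube d p q \<subseteq> U"
    "p \<in> {..<d} \<rightarrow>\<^sub>E \<rat>" "q \<in> {..<d} \<rightarrow>\<^sub>E \<rat>"
proof -
  obtain T where T: "open T" "U = Rn d \<inter> T"
    using assms unfolding openin_Euclidean by auto
  obtain X where X: "x \<in> Pi\<^sub>E UNIV X" "\<And>i. open (X i)" "Pi\<^sub>E UNIV X \<subseteq> T"
  proof -
    have "openin (product_topology (\<lambda>_::nat. euclideanreal) UNIV) T" "x \<in> T"
      using T assms(2) by (auto simp only: euclidean_product_topology open_openin)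
    from product_topology_open_contains_basis[OF this] show ?thesis
      using that by (metis open_openin)
  qed
  have "\<exists>p q. p \<in> \<rat> \<and> q \<in> \<rat> \<and> p < x i \<and> x i < q \<and> {p..q} \<subseteq> X i" for i
  proof -
    have "x i \<in> X i" using X(1) by auto
    then obtain e where e: "e > 0" "cball (x i) e \<subseteq> X i"
      using X(2)[of i] open_contains_cball by blast
    obtain p where p: "p \<in> \<rat>" "x i - e < p" "p < x i"
      using Rats_dense_in_real[of "x i - e" "x i"] e by auto
    obtain q where q: "q \<in> \<rat>" "x i < q" "q < x i + e"
      using Rats_dense_in_real[of "x i" "x i + e"] e by auto
    have "{p..q} \<subseteq> cball (x i) e"
      using p q by (auto simp: dist_real_def)
    then show ?thesis using p q e by blast
  qed
  then obtain p q where pq: "\<And>i. p i \<in> \<rat>" "\<And>i. q i \<in> \<rat>" "\<And>i. p i < x i" "\<And>i. x i < q i" "\<And>i. {p i..q i} \<subseteq> X i"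
    by metis
  have xR: "x \<in> Rn d" using assms(2) T by auto
  show ?thesis
  proof
    show "x \<in> cube d (restrict p {..<d}) (restrict q {..<d})"
      using pq xR by (auto simp: cube_def)
    have "y \<in> Pi\<^sub>E UNIV X" if "y \<in> closed_cube d (restrict p {..<d}) (restrict q {..<d})" for y
    proof -
      have "y i \<in> X i" for i
      proof (cases "i < d")
        case True
        then have "y i \<in> {p i..q i}" using that by (auto simp: closed_cube_def)
        then show ?thesis using pq(5) by blast
      next
        case False
        then have "y i = x i" using that xR by (auto simp: closed_cube_def Rn_iff)
        then show ?thesis using X(1) by auto
      qed
      then show ?thesis by auto
    qed
    then show "closed_cube d (restrict p {..<d}) (restrict q {..<d}) \<subseteq> U"
      using X(3) T(2) unfolding closed_cube_def by fast
  qed (use pq in auto)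
qed

lemma cube_subset_closed_cube: "cube d p q \<subseteq> closed_cube d p q"
  by (auto simp: cube_def closed_cube_def)

text \<open>Nonempty open sets are not null, as they contain cubes of positive volume.\<close>

lemma open_not_null:
  assumes "openin (Euclidean_space d) U" "x \<in> U" "AE y in leb d. P y"
  obtains y where "y \<in> U" "P y"
proof -
  obtain p q where pq: "x \<in> cube d p q" "closed_cube d p q \<subseteq> U"
      "p \<in> {..<d} \<rightarrow>\<^sub>E \<rat>" "q \<in> {..<d} \<rightarrow>\<^sub>E \<rat>"
    by (rule rational_cube_in_open[OF assms(1,2)])
  have lt: "p i < q i" if "i < d" for i using pq(1) that by (fastforce simp: cube_def)
  have "0 < (\<Prod>i<d. q i - p i)"
    using lt by (intro prod_pos) auto
  then have "emeasure (leb d) (cube d p q) \<noteq> 0"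
    using emeasure_leb_cube[of d p q] lt by (simp add: less_imp_le ennreal_eq_0_iff del: prod_zero_iff)
  have "\<exists>y\<in>cube d p q. P y"
  proof (rule ccontr)
    assume "\<not> ?thesis"
    then have "AE y in leb d. y \<notin> cube d p q"
      using assms(3) by (auto elim: eventually_mono)
    then have "emeasure (leb d) (cube d p q) = 0"
      using AE_iff_null_sets[OF sets_lebI[OF cube_in_borel_Rn]] by blast
    then show False using \<open>emeasure (leb d) (cube d p q) \<noteq> 0\<close> by simp
  qed
  then show ?thesis using that pq(2) cube_subset_closed_cube by blast
qed

section \<open>Integration by parts against test functions\<close>

lemma continuous_bounded_on_compact:
  fixes f :: "(nat \<Rightarrow> real) \<Rightarrow> real"
  assumes "continuous_on (Rn d) f" "compact K" "K \<subseteq> Rn d"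
  shows "\<exists>C\<ge>0. \<forall>x\<in>K. \<bar>f x\<bar> \<le> C"
proof -
  have "compact (f ` K)"
    using assms continuous_on_subset compact_continuous_image by blast
  then obtain C where "C > 0" "\<forall>y\<in>f ` K. norm y \<le> C"
    using compact_imp_bounded bounded_pos by blast
  then show ?thesis by (intro exI[of _ C]) auto
qed

lemma integrable_mult_bounded:
  fixes f g :: "'a \<Rightarrow> real"
  assumes "integrable M f" "g \<in> borel_measurable M" "\<And>x. x \<in> space M \<Longrightarrow> \<bar>g x\<bar> \<le> C"
  shows "integrable M (\<lambda>x. f x * g x)"
proof (rule Bochner_Integration.integrable_bound)
  show "integrable M (\<lambda>x. C * f x)" using assms(1) by simp
  show "(\<lambda>x. f x * g x) \<in> borel_measurable M"
    by (intro borel_measurable_times borel_measurable_integrable assms(1,2))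
  have "norm (f x * g x) \<le> norm (C * f x)" if "x \<in> space M" for x
  proof -
    have "\<bar>g x\<bar> * \<bar>f x\<bar> \<le> \<bar>C\<bar> * \<bar>f x\<bar>"
      using assms(3)[OF that] by (intro mult_right_mono) auto
    then show ?thesis by (simp add: abs_mult mult.commute)
  qed
  then show "AE x in M. norm (f x * g x) \<le> norm (C * f x)" by (rule AE_I2)
qed

definition compact_support ::
  "nat \<Rightarrow> (nat \<Rightarrow> real) set \<Rightarrow> (nat \<Rightarrow> real) set \<Rightarrow> ((nat \<Rightarrow> real) \<Rightarrow> real) \<Rightarrow> bool" where
  "compact_support d \<Omega> K \<psi> \<longleftrightarrow>
     compact K \<and> K \<subseteq> Rn d \<and> K \<subseteq> \<Omega> \<and> (\<forall>x\<in>Rn d - K. \<psi> x = 0)"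

text \<open>The derivative is a second function rather than \<open>partial i f\<close>, so that the rules of calculus can
  be applied to composite functions without computing \<open>deriv\<close>.\<close>

definition has_partial ::
  "nat \<Rightarrow> nat \<Rightarrow> ((nat \<Rightarrow> real) \<Rightarrow> real) \<Rightarrow> ((nat \<Rightarrow> real) \<Rightarrow> real) \<Rightarrow> bool" where
  "has_partial d i f f' \<longleftrightarrow>
     (\<forall>x\<in>Rn d. \<forall>t. ((\<lambda>s. f (x(i := s))) has_real_derivative f' (x(i := t))) (at t))"

lemma continuous_measurable_leb: "continuous_on (Rn d) f \<Longrightarrow> f \<in> borel_measurable (leb d)"
  by (intro borel_measurable_lebI continuous_borel_measurable_Rn)

lemma continuous_in_L1_loc:
  assumes "continuous_on (Rn d) f"
  shows "f \<in> L1_loc d \<Omega>"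
  unfolding L1_loc_def compactin_Euclidean set_integrable_def
proof (intro CollectI allI impI)
  fix K assume "(compact K \<and> K \<subseteq> Rn d) \<and> K \<subseteq> \<Omega>"
  then have cK: "compact K" "K \<subseteq> Rn d" by auto
  obtain C where C: "C \<ge> 0" "\<forall>x\<in>K. \<bar>f x\<bar> \<le> C"
    using continuous_bounded_on_compact[OF assms cK] by blast
  have K: "K \<in> sets (leb d)" by (rule compact_in_sets_leb[OF cK])
  have meas: "(\<lambda>x. indicat_real K x *\<^sub>R f x) \<in> borel_measurable (leb d)"
    by (intro borel_measurable_scaleR borel_measurable_indicator K continuous_measurable_leb assms)
  have "integrable (leb d) (\<lambda>x. C * indicat_real K x)"
    by (intro Bochner_Integration.integrable_mult_right integrable_real_indicator K emeasure_leb_compact cK)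
  then show "integrable (leb d) (\<lambda>x. indicat_real K x *\<^sub>R f x)"
    by (rule Bochner_Integration.integrable_bound[OF _ meas]) (use C in \<open>auto simp: indicator_def\<close>)
qed

lemma integrable_L1_loc_mult:
  assumes "u \<in> L1_loc d \<Omega>" "continuous_on (Rn d) \<psi>" "compact_support d \<Omega> K \<psi>"
  shows "integrable (leb d) (\<lambda>x. u x * \<psi> x)"
proof -
  have K: "compact K" "K \<subseteq> Rn d" "K \<subseteq> \<Omega>" "\<And>x. x \<in> Rn d \<Longrightarrow> x \<notin> K \<Longrightarrow> \<psi> x = 0"
    using assms(3) by (auto simp: compact_support_def)
  obtain C where C: "C \<ge> 0" "\<forall>x\<in>K. \<bar>\<psi> x\<bar> \<le> C"
    using continuous_bounded_on_compact[OF assms(2) K(1,2)] by blast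
  have "integrable (leb d) (\<lambda>x. indicator K x *\<^sub>R u x)"
    using assms(1) K(1-3) unfolding L1_loc_def compactin_Euclidean set_integrable_def by blast
  then have "integrable (leb d) (\<lambda>x. (indicator K x *\<^sub>R u x) * \<psi> x)"
  proof (rule integrable_mult_bounded[OF _ continuous_measurable_leb[OF assms(2)]])
    show "\<bar>\<psi> x\<bar> \<le> C" if "x \<in> space (leb d)" for x
      using that C K(4)[of x] by (cases "x \<in> K") (auto simp: space_leb)
  qed
  also have "?this \<longleftrightarrow> ?thesis"
    using K(4) by (intro Bochner_Integration.integrable_cong refl) (auto simp: space_leb indicator_def)
  finally show ?thesis .
qed

lemma integrable_compact_support:
  assumes "continuous_on (Rn d) \<psi>" "compact_support d \<Omega> K \<psi>"
  shows "integrable (leb d) \<psi>"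
proof -
  have "(\<lambda>_. 1) \<in> L1_loc d \<Omega>" by (rule continuous_in_L1_loc) simp
  from integrable_L1_loc_mult[OF this assms] show ?thesis by simp
qed

lemma set_integral_supported:
  assumes "compact_support d \<Omega> K g"
  shows "(LINT x:\<Omega>|leb d. g x) = integral\<^sup>L (leb d) g"
  unfolding set_lebesgue_integral_def
  using assms by (intro Bochner_Integration.integral_cong refl)
    (auto simp: space_leb indicator_def compact_support_def)

lemma compact_support_mult:
  "compact_support d \<Omega> K \<psi> \<Longrightarrow> compact_support d \<Omega> K (\<lambda>x. f x * \<psi> x)"
  by (auto simp: compact_support_def)

text \<open>Off the compact support the function is zero in a neighbourhood of each point of the line, hence
  so is its derivative there.\<close>

lemma compact_support_partial:
  assumes "has_partial d i \<phi> \<phi>'" "compact_support d \<Omega> K \<phi>" "i < d"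
  shows "compact_support d \<Omega> K \<phi>'"
proof -
  have K: "compact K" "\<And>x. x \<in> Rn d \<Longrightarrow> x \<notin> K \<Longrightarrow> \<phi> x = 0"
    using assms(2) by (auto simp: compact_support_def)
  have "\<phi>' x = 0" if x: "x \<in> Rn d" "x \<notin> K" for x
  proof -
    let ?S = "(\<lambda>t. x(i := t)) -` (- K)"
    have "open ?S"
      by (rule open_vimage[OF open_Compl[OF compact_imp_closed[OF K(1)]] continuous_fun_upd])
    moreover have "x i \<in> ?S" using x by simp
    moreover have "0 = \<phi> (x(i := t))" if "t \<in> ?S" for t
      using that K(2)[OF fun_upd_Rn[OF x(1) assms(3)]] by auto
    moreover have "((\<lambda>_. 0::real) has_real_derivative 0) (at (x i))" by simp
    ultimately have "((\<lambda>s. \<phi> (x(i := s))) has_real_derivative 0) (at (x i))"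
      by (metis (no_types, lifting) has_field_derivative_transform_within_open)
    moreover have "((\<lambda>s. \<phi> (x(i := s))) has_real_derivative \<phi>' (x(i := x i))) (at (x i))"
      using assms(1) x unfolding has_partial_def by blast
    ultimately show ?thesis by (auto dest: DERIV_unique)
  qed
  then show ?thesis using assms(2) by (auto simp: compact_support_def)
qed

text \<open>The fundamental theorem of calculus on each line in direction \<open>i\<close>, integrated over
  the remaining coordinates.\<close>

lemma integral_partial_eq_0:
  assumes deriv: "has_partial d i \<phi> \<phi>'" and cont: "continuous_on (Rn d) \<phi>'"
    and supp: "compact_support d \<Omega> K \<phi>" and i: "i < d"
  shows "integral\<^sup>L (leb d) \<phi>' = 0"
proof -
  have K: "compact K" "K \<subseteq> Rn d" "\<And>x. x \<in> Rn d \<Longrightarrow> x \<notin> K \<Longrightarrow> \<phi> x = 0"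
    using supp by (auto simp: compact_support_def)
  have supp': "compact_support d \<Omega> K \<phi>'"
    by (rule compact_support_partial[OF deriv supp i])
  then have off: "\<phi>' x = 0" if "x \<in> Rn d" "x \<notin> K" for x
    using that by (auto simp: compact_support_def)
  have meas: "\<phi>' \<in> borel_measurable (borel_Rn d)"
    by (rule continuous_borel_measurable_Rn[OF cont])
  obtain B where B: "B > 0" "\<And>x j. x \<in> K \<Longrightarrow> j < d \<Longrightarrow> \<bar>x j\<bar> < B"
    using compact_coordinates_bounded[OF K(1), of d] by blast
  define J where "J = {..<d} - {i}"
  have J: "finite J" "i \<notin> J" "{..<d} = insert i J"
    using i by (auto simp: J_def)
  have "integrable (lborel_prod d) (\<lambda>x. \<phi>' (pad d x))"
    using integrable_compact_support[OF cont supp'] integrable_leb_iff[OF meas] by blast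
  then have int: "integrable (Pi\<^sub>M (insert i J) (\<lambda>_. lborel)) (\<lambda>x. \<phi>' (pad d x))"
    by (simp only: J)
  have "integral\<^sup>L (leb d) \<phi>' = (\<integral>x. \<phi>' (pad d x) \<partial>Pi\<^sub>M (insert i J) (\<lambda>_. lborel))"
    using integral_leb[OF meas] by (simp only: J)
  also have "\<dots> = (\<integral>x. (\<integral>y. \<phi>' (pad d (x(i := y))) \<partial>lborel) \<partial>Pi\<^sub>M J (\<lambda>_. lborel))"
    by (rule lborel_product.product_integral_insert[OF J(1,2) int])
  also have "\<dots> = (\<integral>x. 0 \<partial>Pi\<^sub>M J (\<lambda>_. lborel :: real measure))"
  proof (rule Bochner_Integration.integral_cong[OF refl])
    fix x :: "nat \<Rightarrow> real"
    let ?x = "pad d x"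
    have upd: "pad d (x(i := y)) = ?x(i := y)" for y
      using i by (auto simp: pad_def)
    have R: "?x(i := y) \<in> Rn d" for y
      by (rule fun_upd_Rn[OF pad_in_Rn i])
    have notK: "?x(i := y) \<notin> K" if "B \<le> \<bar>y\<bar>" for y
      using B(2)[of "?x(i := y)" i] i that by auto
    have "continuous_on UNIV (\<lambda>y. \<phi>' (?x(i := y)))"
      by (rule continuous_on_compose2[OF cont continuous_fun_upd]) (use R in blast)
    then have cont': "isCont (\<lambda>y. \<phi>' (?x(i := y))) y" for y
      by (simp add: continuous_on_eq_continuous_at)
    have "(\<integral>y. \<phi>' (pad d (x(i := y))) \<partial>lborel) = (\<integral>y. \<phi>' (?x(i := y)) * indicator {-B..B} y \<partial>lborel)"
      unfolding upd
    proof (rule Bochner_Integration.integral_cong[OF refl])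
      fix y show "\<phi>' (?x(i := y)) = \<phi>' (?x(i := y)) * indicator {-B..B} y"
        using off[OF R notK, of y] by (cases "y \<in> {-B..B}") auto
    qed
    also have "\<dots> = \<phi> (?x(i := B)) - \<phi> (?x(i := -B))"
    proof (rule integral_FTC_Icc_real)
      fix y show "((\<lambda>s. \<phi> (?x(i := s))) has_real_derivative \<phi>' (?x(i := y))) (at y)"
        using deriv pad_in_Rn unfolding has_partial_def by blast
    qed (use B(1) cont' in auto)
    also have "\<dots> = 0"
      using K(3)[OF R notK, of B] K(3)[OF R notK, of "-B"] B(1) by simp
    finally show "(\<integral>y. \<phi>' (pad d (x(i := y))) \<partial>lborel) = 0" .
  qed
  finally show ?thesis by simp
qed

definition smooth_Rn :: "nat \<Rightarrow> ((nat \<Rightarrow> real) \<Rightarrow> real) \<Rightarrow> bool" where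
  "smooth_Rn d f \<longleftrightarrow> (\<forall>k. Ck_on d k (Rn d) f)"

lemma Ck_on_continuous: "Ck_on d k (Rn d) f \<Longrightarrow> continuous_on (Rn d) f"
  using Ck_on_0[of "Rn d" d f] by (cases k) auto

lemma Ck_on_has_partial:
  assumes "Ck_on d (Suc k) (Rn d) f" "i < d"
  shows "has_partial d i f (partial i f)"
  unfolding has_partial_def
proof (intro ballI allI)
  fix x t assume "x \<in> Rn d"
  then have "x(i := t) \<in> Rn d" by (rule fun_upd_Rn[OF _ assms(2)])
  then have "(\<lambda>s. f ((x(i := t))(i := s))) differentiable (at ((x(i := t)) i))"
    using assms unfolding Ck_on.simps by blast
  then show "((\<lambda>s. f (x(i := s))) has_real_derivative partial i f (x(i := t))) (at t)"
    unfolding partial_def by (simp add: DERIV_deriv_iff_real_differentiable)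
qed

lemma smooth_continuous: "smooth_Rn d f \<Longrightarrow> continuous_on (Rn d) f"
  unfolding smooth_Rn_def using Ck_on_continuous by blast

lemma smooth_partial: "smooth_Rn d f \<Longrightarrow> i < d \<Longrightarrow> smooth_Rn d (partial i f)"
  unfolding smooth_Rn_def by (metis Ck_on.simps(2))

lemma smooth_has_partial: "smooth_Rn d f \<Longrightarrow> i < d \<Longrightarrow> has_partial d i f (partial i f)"
  unfolding smooth_Rn_def using Ck_on_has_partial by blast

lemma smooth_partials: "smooth_Rn d f \<Longrightarrow> set \<alpha> \<subseteq> {..<d} \<Longrightarrow> smooth_Rn d (partials \<alpha> f)"
  unfolding partials_def by (induction \<alpha>) (auto intro: smooth_partial)

lemma test_functions_iff:
  "\<phi> \<in> test_functions d \<Omega> \<longleftrightarrow> smooth_Rn d \<phi> \<and> (\<exists>K. compact_support d \<Omega> K \<phi>)"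
  unfolding test_functions_def smooth_Rn_def compactin_Euclidean compact_support_def by auto

lemma test_functions_partial:
  "\<phi> \<in> test_functions d \<Omega> \<Longrightarrow> i < d \<Longrightarrow> partial i \<phi> \<in> test_functions d \<Omega>"
  unfolding test_functions_iff using smooth_partial smooth_has_partial compact_support_partial by blast

lemma test_functions_partials:
  assumes "\<phi> \<in> test_functions d \<Omega>" "set \<alpha> \<subseteq> {..<d}"
  shows "partials \<alpha> \<phi> \<in> test_functions d \<Omega>"
  using assms(2) unfolding partials_def by (induction \<alpha>) (auto intro: test_functions_partial assms(1))

lemma integrable_L1_loc_test:
  assumes "u \<in> L1_loc d \<Omega>" "\<phi> \<in> test_functions d \<Omega>"
  shows "integrable (leb d) (\<lambda>x. u x * \<phi> x)"
  using assms integrable_L1_loc_mult smooth_continuous unfolding test_functions_iff by blast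

lemma set_integral_test:
  assumes "\<phi> \<in> test_functions d \<Omega>"
  shows "(LINT x:\<Omega>|leb d. u x * \<phi> x) = (LINT x|leb d. u x * \<phi> x)"
  using assms compact_support_mult set_integral_supported unfolding test_functions_iff by blast

lemma integration_by_parts:
  assumes f: "has_partial d i f f'"
    and cont: "continuous_on (Rn d) f" "continuous_on (Rn d) f'"
    and \<phi>: "\<phi> \<in> test_functions d \<Omega>" and i: "i < d"
  shows "(LINT x|leb d. f x * partial i \<phi> x) = - (LINT x|leb d. f' x * \<phi> x)"
proof -
  obtain K where K: "smooth_Rn d \<phi>" "compact_support d \<Omega> K \<phi>"
    using \<phi> unfolding test_functions_iff by blast
  have int: "integrable (leb d) (\<lambda>x. f x * partial i \<phi> x)" "integrable (leb d) (\<lambda>x. f' x * \<phi> x)"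
    by (rule integrable_L1_loc_test[where \<Omega> = \<Omega>] continuous_in_L1_loc test_functions_partial cont \<phi> i)+
  have "has_partial d i (\<lambda>x. f x * \<phi> x) (\<lambda>x. f x * partial i \<phi> x + f' x * \<phi> x)"
    unfolding has_partial_def
  proof (intro ballI allI)
    fix x t assume x: "x \<in> Rn d"
    have "((\<lambda>s. f (x(i := s))) has_real_derivative f' (x(i := t))) (at t)"
      "((\<lambda>s. \<phi> (x(i := s))) has_real_derivative partial i \<phi> (x(i := t))) (at t)"
      using f smooth_has_partial[OF K(1) i] x unfolding has_partial_def by blast+
    from DERIV_mult[OF this]
    show "((\<lambda>s. f (x(i := s)) * \<phi> (x(i := s))) has_real_derivative
      f (x(i := t)) * partial i \<phi> (x(i := t)) + f' (x(i := t)) * \<phi> (x(i := t))) (at t)"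
      by (simp add: algebra_simps)
  qed
  moreover have "continuous_on (Rn d) (\<lambda>x. f x * partial i \<phi> x + f' x * \<phi> x)"
    by (intro continuous_on_add continuous_on_mult cont smooth_continuous smooth_partial K(1) i)
  ultimately have "(LINT x|leb d. f x * partial i \<phi> x + f' x * \<phi> x) = 0"
    by (rule integral_partial_eq_0[OF _ _ compact_support_mult[OF K(2)] i])
  then show ?thesis
    using int by simp
qed

text \<open>Integration by parts moves the outermost derivative of the test function first, which reverses
  the order of differentiation.\<close>

lemma smooth_has_weak_deriv:
  assumes "smooth_Rn d f" "set \<alpha> \<subseteq> {..<d}"
  shows "has_weak_deriv d \<Omega> \<alpha> f (partials (rev \<alpha>) f)"
proof -
  have *: "(LINT x|leb d. f x * partials \<alpha> \<phi> x) = (- 1) ^ length \<alpha> * (LINT x|leb d. partials (rev \<alpha>) f x * \<phi> x)"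
    if "\<phi> \<in> test_functions d \<Omega>" for \<phi>
    using assms
  proof (induction \<alpha> arbitrary: f)
    case Nil
    then show ?case by (simp add: partials_def)
  next
    case (Cons i \<alpha>)
    then have i: "i < d" and \<alpha>: "set \<alpha> \<subseteq> {..<d}" by auto
    have "(LINT x|leb d. f x * partials (i # \<alpha>) \<phi> x) = (LINT x|leb d. f x * partial i (partials \<alpha> \<phi>) x)"
      by (simp add: partials_def)
    also have "\<dots> = - (LINT x|leb d. partial i f x * partials \<alpha> \<phi> x)"
      by (rule integration_by_parts[OF smooth_has_partial[OF Cons.prems(1) i] smooth_continuous[OF Cons.prems(1)]
          smooth_continuous[OF smooth_partial[OF Cons.prems(1) i]] test_functions_partials[OF that \<alpha>] i])
    also have "\<dots> = - ((- 1) ^ length \<alpha> * (LINT x|leb d. partials (rev \<alpha>) (partial i f) x * \<phi> x))"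
      using Cons.IH[OF smooth_partial[OF Cons.prems(1) i] \<alpha>] by simp
    finally show ?case by (simp add: partials_def)
  qed
  have "partials (rev \<alpha>) f \<in> L1_loc d \<Omega>" "f \<in> L1_loc d \<Omega>"
    using assms by (auto intro!: continuous_in_L1_loc smooth_continuous smooth_partials)
  moreover have "(LINT x:\<Omega>|leb d. f x * partials \<alpha> \<phi> x) = (- 1) ^ length \<alpha> * (LINT x:\<Omega>|leb d. partials (rev \<alpha>) f x * \<phi> x)"
    if "\<phi> \<in> test_functions d \<Omega>" for \<phi>
    unfolding set_integral_test[OF that] set_integral_test[OF test_functions_partials[OF that assms(2)]]
    by (rule *[OF that])
  ultimately show ?thesis
    unfolding has_weak_deriv_def by blast
qed

section \<open>Smooth bump functions and the fundamental lemma of the calculus of variations\<close>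

text \<open>Functions of one variable with \<open>n\<close> continuous derivatives. The derivative is existentially
  quantified so that the closure properties follow by induction from the rules of differentiation.\<close>

primrec smooth1 :: "nat \<Rightarrow> (real \<Rightarrow> real) \<Rightarrow> bool" where
  "smooth1 0 f \<longleftrightarrow> continuous_on UNIV f"
| "smooth1 (Suc n) f \<longleftrightarrow> (\<exists>f'. (\<forall>x. (f has_real_derivative f' x) (at x)) \<and> smooth1 n f')"

lemma smooth1_SucI:
  "(\<And>x. (f has_real_derivative f' x) (at x)) \<Longrightarrow> smooth1 n f' \<Longrightarrow> smooth1 (Suc n) f"
  by auto

lemma smooth1_continuous:
  assumes "smooth1 n f" shows "continuous_on UNIV f"
proof (cases n)
  case (Suc m)
  then obtain f' where "\<And>x. (f has_real_derivative f' x) (at x)" using assms by auto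
  then show ?thesis by (intro continuous_at_imp_continuous_on ballI DERIV_isCont)
qed (use assms in simp)

lemma smooth1_Suc: "smooth1 (Suc n) f \<Longrightarrow> smooth1 n f"
proof (induction n arbitrary: f)
  case 0
  then show ?case using smooth1_continuous by (metis smooth1.simps(1))
next
  case (Suc n)
  then show ?case by (metis smooth1.simps(2))
qed

lemma smooth1_const: "smooth1 n (\<lambda>_. c)"
proof (induction n arbitrary: c)
  case (Suc n)
  have "\<forall>x. ((\<lambda>_. c) has_real_derivative 0) (at x)" by simp
  then show ?case using Suc[of 0] unfolding smooth1.simps by (intro exI[of _ "\<lambda>_. 0"] conjI)
qed simp

lemma smooth1_add: "smooth1 n f \<Longrightarrow> smooth1 n g \<Longrightarrow> smooth1 n (\<lambda>x. f x + g x)"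
proof (induction n arbitrary: f g)
  case 0
  then show ?case by (simp add: continuous_on_add)
next
  case (Suc n)
  obtain f' g' where *: "\<forall>x. (f has_real_derivative f' x) (at x)" "smooth1 n f'"
    "\<forall>x. (g has_real_derivative g' x) (at x)" "smooth1 n g'"
    using Suc.prems unfolding smooth1.simps by blast
  show ?case unfolding smooth1.simps
    using * Suc.IH[OF *(2,4)] by (intro exI[of _ "\<lambda>x. f' x + g' x"] conjI allI DERIV_add) auto
qed

lemma smooth1_mult: "smooth1 n f \<Longrightarrow> smooth1 n g \<Longrightarrow> smooth1 n (\<lambda>x. f x * g x)"
proof (induction n arbitrary: f g)
  case 0
  then show ?case by (simp add: continuous_on_mult)
next
  case (Suc n)
  obtain f' g' where *: "\<forall>x. (f has_real_derivative f' x) (at x)" "smooth1 n f'"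
    "\<forall>x. (g has_real_derivative g' x) (at x)" "smooth1 n g'"
    using Suc.prems unfolding smooth1.simps by blast
  have fg: "smooth1 n f" "smooth1 n g" using Suc.prems by (blast intro: smooth1_Suc)+
  show ?case unfolding smooth1.simps
    using * by (intro exI[of _ "\<lambda>x. f' x * g x + g' x * f x"] conjI allI DERIV_mult smooth1_add Suc.IH fg) auto
qed

lemma smooth1_exp: "smooth1 n f \<Longrightarrow> smooth1 n (\<lambda>x. exp (f x))"
proof (induction n arbitrary: f)
  case 0
  then show ?case by (simp add: continuous_on_exp)
next
  case (Suc n)
  obtain f' where *: "\<forall>x. (f has_real_derivative f' x) (at x)" "smooth1 n f'"
    using Suc.prems unfolding smooth1.simps by blast
  have "((\<lambda>x. exp (f x)) has_real_derivative exp (f x) * f' x) (at x)" for x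
    using * by (auto intro: DERIV_chain2[OF DERIV_exp])
  then show ?case
    by (rule smooth1_SucI) (rule smooth1_mult[OF Suc.IH[OF smooth1_Suc[OF Suc.prems]] *(2)])
qed

lemma smooth1_affine: "smooth1 n f \<Longrightarrow> smooth1 n (\<lambda>x. f (a * x + b))"
proof (induction n arbitrary: f)
  case 0
  then have "continuous_on UNIV f" by simp
  then show ?case unfolding smooth1.simps
    by (rule continuous_on_compose2) (auto intro!: continuous_intros)
next
  case (Suc n)
  obtain f' where *: "\<forall>x. (f has_real_derivative f' x) (at x)" "smooth1 n f'"
    using Suc.prems unfolding smooth1.simps by blast
  have "((\<lambda>x. f (a * x + b)) has_real_derivative f' (a * x + b) * a) (at x)" for x
    by (rule DERIV_chain2[of f "f' (a * x + b)"]) (use * in \<open>auto intro!: derivative_eq_intros\<close>)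
  then show ?case
    by (rule smooth1_SucI) (rule smooth1_mult[OF Suc.IH[OF *(2)] smooth1_const])
qed

text \<open>The functions \<open>x\<^sup>-\<^sup>k exp (- 1/x)\<close>, extended by zero to \<open>x \<le> 0\<close>. Their span is closed under
  differentiation, which is how all of them are seen to be smooth.\<close>

definition flat :: "nat \<Rightarrow> real \<Rightarrow> real" where
  "flat k x = (if x > 0 then inverse x ^ k * exp (- inverse x) else 0)"

lemma flat_tendsto_0: "(flat k \<longlongrightarrow> 0) (at 0)"
proof (rule filterlim_split_at)
  show "(flat k \<longlongrightarrow> 0) (at_left 0)"
    by (rule tendsto_eventually) (auto simp: flat_def eventually_at_filter)
  have "((\<lambda>x::real. inverse x ^ k / exp (inverse x)) \<longlongrightarrow> 0) (at_right 0)"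
    by (rule filterlim_compose[OF tendsto_power_div_exp_0 filterlim_inverse_at_top_right])
  then show "(flat k \<longlongrightarrow> 0) (at_right 0)"
    by (rule Lim_transform_eventually)
      (auto simp: flat_def eventually_at_filter exp_minus divide_inverse)
qed

lemma flat_deriv: "(flat k has_real_derivative flat (k + 2) x + (- real k) * flat (k + 1) x) (at x)"
proof (cases x "0 :: real" rule: linorder_cases)
  case less
  have "((\<lambda>_. 0) has_real_derivative 0) (at x)" by simp
  then have "(flat k has_real_derivative 0) (at x)"
    by (rule has_field_derivative_transform_within_open[of _ _ _ "{..<0}"]) (use less in \<open>auto simp: flat_def\<close>)
  then show ?thesis using less by (simp add: flat_def)
next
  case equal
  have "((\<lambda>h. (flat k (0 + h) - flat k 0) / h) \<longlongrightarrow> 0) (at 0)"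
    by (rule Lim_transform_eventually[OF flat_tendsto_0[of "k + 1"]])
      (auto simp: flat_def eventually_at_filter divide_inverse)
  then show ?thesis using equal by (simp add: DERIV_def flat_def)
next
  case greater
  have inv: "((\<lambda>x. inverse x) has_real_derivative - (inverse x)\<^sup>2) (at x)"
    using DERIV_inverse[of x UNIV] greater by (simp add: power2_eq_square)
  have "((\<lambda>x. exp (- inverse x)) has_real_derivative exp (- inverse x) * - (- (inverse x)\<^sup>2)) (at x)"
    by (intro DERIV_chain2[OF DERIV_exp] DERIV_minus inv)
  from DERIV_mult[OF DERIV_power[OF inv, of k] this]
  have "((\<lambda>x. inverse x ^ k * exp (- inverse x)) has_real_derivative
     inverse x ^ (k + 2) * exp (- inverse x) + (- real k) * (inverse x ^ (k + 1) * exp (- inverse x))) (at x)"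
    by (rule DERIV_cong) (cases k; simp add: power2_eq_square algebra_simps)
  then have "(flat k has_real_derivative
     inverse x ^ (k + 2) * exp (- inverse x) + (- real k) * (inverse x ^ (k + 1) * exp (- inverse x))) (at x)"
    by (rule has_field_derivative_transform_within_open[of _ _ _ "{0<..}"]) (use greater in \<open>auto simp: flat_def\<close>)
  then show ?thesis using greater by (simp add: flat_def)
qed

lemma smooth1_flat: "smooth1 n (flat k)"
proof (induction n arbitrary: k)
  case 0
  show ?case unfolding smooth1.simps
    by (intro continuous_at_imp_continuous_on ballI DERIV_isCont[OF flat_deriv])
next
  case (Suc n)
  show ?case
    by (rule smooth1_SucI[OF flat_deriv]) (rule smooth1_add[OF Suc smooth1_mult[OF smooth1_const Suc]])
qed

text \<open>The product \<open>flat 0 (x - a) * flat 0 (b - x)\<close> is smooth and positive exactly on \<open>(a, b)\<close>, so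
  composing it with \<open>y \<mapsto> 1 - exp (- c y)\<close> gives smooth functions with values in \<open>[0, 1]\<close> that increase
  to the indicator of the interval as \<open>c\<close> grows. Differences are written as sums and multiples to
  match the closure rules of \<open>smooth1\<close>.\<close>

definition bump :: "real \<Rightarrow> real \<Rightarrow> real \<Rightarrow> real \<Rightarrow> real" where
  "bump a b c x = 1 + (- 1) * exp ((- c) * (flat 0 (1 * x + (- a)) * flat 0 ((- 1) * x + b)))"

lemma smooth1_bump: "smooth1 n (bump a b c)"
  unfolding bump_def
  by (intro smooth1_add smooth1_mult smooth1_const smooth1_exp smooth1_affine smooth1_flat)

lemma flat_nonneg: "0 \<le> flat k x" and flat_pos_iff: "0 < flat k x \<longleftrightarrow> 0 < x"
  by (auto simp: flat_def)

lemma bump_bounds: "0 \<le> c \<Longrightarrow> 0 \<le> bump a b c x" "bump a b c x \<le> 1"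
  by (auto simp: bump_def flat_nonneg)

lemma bump_outside: "x \<notin> {a<..<b} \<Longrightarrow> bump a b c x = 0"
  by (auto simp: bump_def flat_def)

lemma bump_tendsto: "(\<lambda>n. bump a b (real n) x) \<longlonglongrightarrow> indicator {a<..<b} x"
proof (cases "x \<in> {a<..<b}")
  case True
  define y where "y = flat 0 (1 * x + (- a)) * flat 0 ((- 1) * x + b)"
  have "y > 0" using True unfolding y_def by (intro mult_pos_pos) (auto simp: flat_pos_iff)
  then have "filterlim (\<lambda>n. y * real n) at_top sequentially"
    by (intro filterlim_tendsto_pos_mult_at_top[OF tendsto_const] filterlim_real_sequentially)
  then have "filterlim (\<lambda>n. - (y * real n)) at_bot sequentially"
    by (simp add: filterlim_uminus_at_bot)
  then have "(\<lambda>n. exp (- (y * real n))) \<longlonglongrightarrow> 0"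
    by (rule filterlim_compose[OF exp_at_bot])
  then have "(\<lambda>n. 1 + (- 1) * exp (- (y * real n))) \<longlonglongrightarrow> 1 + (- 1) * 0"
    by (intro tendsto_intros)
  moreover have "bump a b (real n) x = 1 + (- 1) * exp (- (y * real n))" for n
    by (simp add: bump_def y_def mult_ac)
  ultimately show ?thesis using True by simp
qed (simp add: bump_outside)

text \<open>Tensor products of functions of one variable are stable under partial derivatives, so their
  smoothness in several variables reduces to that of the factors.\<close>

definition coord_prod :: "nat \<Rightarrow> (nat \<Rightarrow> real \<Rightarrow> real) \<Rightarrow> (nat \<Rightarrow> real) \<Rightarrow> real" where
  "coord_prod d f x = (\<Prod>j<d. f j (x j))"

lemma coord_prod_deriv:
  assumes "i < d" "\<And>t. (f i has_real_derivative g t) (at t)"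
  shows "((\<lambda>s. coord_prod d f (x(i := s))) has_real_derivative coord_prod d (f(i := g)) (x(i := t))) (at t)"
proof -
  define P where "P = (\<Prod>j\<in>{..<d} - {i}. f j (x j))"
  have split: "coord_prod d h (x(i := s)) = h i s * P" if "\<And>j. j \<noteq> i \<Longrightarrow> h j = f j" for h s
  proof -
    have "coord_prod d h (x(i := s)) = h i ((x(i := s)) i) * (\<Prod>j\<in>{..<d} - {i}. h j ((x(i := s)) j))"
      unfolding coord_prod_def by (rule prod.remove) (use assms(1) in auto)
    also have "(\<Prod>j\<in>{..<d} - {i}. h j ((x(i := s)) j)) = P"
      unfolding P_def by (rule prod.cong) (use that in auto)
    finally show ?thesis unfolding fun_upd_same .
  qed
  have "((\<lambda>s. f i s * P) has_real_derivative g t * P) (at t)"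
    by (rule DERIV_cmult_right[OF assms(2)])
  then show ?thesis by (simp add: split)
qed

lemma partial_coord_prod:
  assumes "i < d" "\<And>t. (f i has_real_derivative g t) (at t)"
  shows "partial i (coord_prod d f) = coord_prod d (f(i := g))"
proof
  fix x show "partial i (coord_prod d f) x = coord_prod d (f(i := g)) x"
    using DERIV_imp_deriv[OF coord_prod_deriv[of i d f g x "x i", OF assms]] by (simp add: partial_def)
qed

lemma Ck_on_coord_prod:
  assumes "\<And>j. j < d \<Longrightarrow> smooth1 k (f j)"
  shows "Ck_on d k (Rn d) (coord_prod d f)"
  using assms
proof (induction k arbitrary: f)
  case 0
  have "continuous_on (Rn d) (\<lambda>x. f j (x j))" if "j < d" for j
  proof (rule continuous_on_compose2[of UNIV "f j"])
    show "continuous_on UNIV (f j)" using 0[OF that] by simp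
    show "continuous_on (Rn d) (\<lambda>x. x j)"
      by (rule continuous_on_subset[OF continuous_on_product_coordinates]) simp
  qed simp
  then show ?case
    unfolding Ck_on_0[OF order_refl] coord_prod_def by (intro continuous_on_prod) auto
next
  case (Suc k)
  have "\<exists>g. \<forall>t. (f i has_real_derivative g t) (at t) \<and> smooth1 k g" if "i < d" for i
    using Suc.prems[OF that] by auto
  then obtain g where g: "\<And>i t. i < d \<Longrightarrow> (f i has_real_derivative g i t) (at t)" "\<And>i. i < d \<Longrightarrow> smooth1 k (g i)"
    by metis
  have "Ck_on d k (Rn d) (coord_prod d f)"
    by (rule Suc.IH) (use Suc.prems smooth1_Suc in blast)
  then have "continuous_map (subtopology (Euclidean_space d) (Rn d)) euclideanreal (coord_prod d f)"
    by (cases k) auto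
  moreover have "(\<lambda>t. coord_prod d f (x(i := t))) differentiable (at (x i))" if "i < d" for i x
    using coord_prod_deriv[of i d f "g i", OF that g(1)[OF that]] real_differentiable_def by blast
  moreover have "Ck_on d k (Rn d) (partial i (coord_prod d f))" if "i < d" for i
  proof -
    have "smooth1 k ((f(i := g i)) j)" if "j < d" for j
      using g(2)[OF that] smooth1_Suc[OF Suc.prems[OF that]] by auto
    then show ?thesis
      unfolding partial_coord_prod[of i d f "g i", OF that g(1)[OF that]] by (rule Suc.IH)
  qed
  ultimately show ?case by simp
qed

lemma bump_product_test_function:
  assumes "closed_cube d p q \<subseteq> \<Omega>"
  shows "coord_prod d (\<lambda>i. bump (p i) (q i) c) \<in> test_functions d \<Omega>"
  unfolding test_functions_iff smooth_Rn_def compact_support_def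
proof (intro conjI allI exI[of _ "closed_cube d p q"] ballI)
  show "Ck_on d k (Rn d) (coord_prod d (\<lambda>i. bump (p i) (q i) c))" for k
    by (rule Ck_on_coord_prod) (rule smooth1_bump)
  show "coord_prod d (\<lambda>i. bump (p i) (q i) c) x = 0" if x: "x \<in> Rn d - closed_cube d p q" for x
  proof -
    obtain i where "i < d" "x i \<notin> {p i<..<q i}"
      using x by (force simp: closed_cube_def)
    then show ?thesis
      unfolding coord_prod_def by (intro prod_zero bexI[of _ i] bump_outside) auto
  qed
qed (use assms compact_closed_cube in \<open>auto simp: closed_cube_def\<close>)

lemma bump_product_tendsto:
  assumes "x \<in> Rn d"
  shows "(\<lambda>n. coord_prod d (\<lambda>i. bump (p i) (q i) (real n)) x) \<longlonglongrightarrow> indicator (cube d p q) x"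
proof -
  have "(\<lambda>n. coord_prod d (\<lambda>i. bump (p i) (q i) (real n)) x) \<longlonglongrightarrow> (\<Prod>i<d. indicator {p i<..<q i} (x i))"
    unfolding coord_prod_def by (intro tendsto_prod bump_tendsto)
  also have "(\<Prod>i<d. indicator {p i<..<q i} (x i)) = (indicator (cube d p q) x :: real)"
  proof (cases "x \<in> cube d p q")
    case True
    then show ?thesis by (auto simp: cube_def indicator_def intro!: prod.neutral)
  next
    case False
    then obtain i where "i < d" "x i \<notin> {p i<..<q i}"
      using assms by (auto simp: cube_def)
    then show ?thesis using False by (auto intro!: prod_zero bexI[of _ i])
  qed
  finally show ?thesis .
qed

lemma bump_product_bounds: "\<bar>coord_prod d (\<lambda>i. bump (p i) (q i) (real n)) x\<bar> \<le> 1"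
proof -
  have "0 \<le> coord_prod d (\<lambda>i. bump (p i) (q i) (real n)) x"
    unfolding coord_prod_def by (intro prod_nonneg bump_bounds ballI) auto
  moreover have "coord_prod d (\<lambda>i. bump (p i) (q i) (real n)) x \<le> 1"
    unfolding coord_prod_def by (intro prod_le_1 conjI bump_bounds) auto
  ultimately show ?thesis by simp
qed

lemma cube_Int: "cube d p q \<inter> cube d a b = cube d (\<lambda>i. max (p i) (a i)) (\<lambda>i. min (q i) (b i))"
  by (auto simp: cube_def)

lemma open_countable_union_cubes:
  assumes "openin (Euclidean_space d) U"
  shows "\<exists>F. countable F \<and> (\<forall>(p, q)\<in>F. closed_cube d p q \<subseteq> U) \<and> U = (\<Union>(p, q)\<in>F. cube d p q)"
proof -
  define Q where "Q = ({..<d} \<rightarrow>\<^sub>E \<rat> :: (nat \<Rightarrow> real) set)"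
  define F where "F = {(p, q) \<in> Q \<times> Q. closed_cube d p q \<subseteq> U}"
  have "countable Q" unfolding Q_def by (intro countable_PiE countable_rat) auto
  then have "countable (Q \<times> Q)" by simp
  then have "countable F" by (rule countable_subset[rotated]) (auto simp: F_def)
  moreover have "U = (\<Union>(p, q)\<in>F. cube d p q)"
  proof (rule set_eqI, rule iffI)
    fix x assume x: "x \<in> U"
    obtain p q where "x \<in> cube d p q" "closed_cube d p q \<subseteq> U" "p \<in> Q" "q \<in> Q"
      unfolding Q_def by (rule rational_cube_in_open[OF assms x])
    then show "x \<in> (\<Union>(p, q)\<in>F. cube d p q)" unfolding F_def by blast
  next
    fix x assume "x \<in> (\<Union>(p, q)\<in>F. cube d p q)"
    then obtain p q where "x \<in> cube d p q" "closed_cube d p q \<subseteq> U"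
      unfolding F_def by blast
    then show "x \<in> U" using cube_subset_closed_cube[of d p q] by blast
  qed
  moreover have "\<forall>(p, q)\<in>F. closed_cube d p q \<subseteq> U" by (auto simp: F_def)
  ultimately show ?thesis by blast
qed

text \<open>Open sets are countable unions of cubes, so cubes generate the Borel sets.\<close>

lemma sets_borel_Rn_subset: "sets (borel_Rn d) \<subseteq> sigma_sets (Rn d) (range (\<lambda>(p, q). cube d p q))"
proof -
  have "Rn d \<inter> B \<in> sigma_sets (Rn d) (range (\<lambda>(p, q). cube d p q))" if "B \<in> sigma_sets UNIV {S. open S}" for B
    using that
  proof (induction rule: sigma_sets.induct)
    case (Basic T)
    then have "openin (Euclidean_space d) (Rn d \<inter> T)"
      unfolding openin_Euclidean by blast
    then obtain F where F: "countable F" "Rn d \<inter> T = (\<Union>(p, q)\<in>F. cube d p q)"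
      using open_countable_union_cubes by metis
    have "countable ((\<lambda>(p, q). cube d p q) ` F)" using F(1) by (rule countable_image)
    then have "\<Union>((\<lambda>(p, q). cube d p q) ` F) \<in> sigma_sets (Rn d) (range (\<lambda>(p, q). cube d p q))"
      by (rule sigma_sets_UNION) (rule sigma_sets.Basic, erule rev_subsetD, rule image_mono, rule subset_UNIV)
    then show ?case unfolding F(2) .
  next
    case Empty
    show ?case unfolding Int_empty_right by (rule sigma_sets.Empty)
  next
    case (Compl a)
    have eq: "Rn d \<inter> (UNIV - a) = Rn d - (Rn d \<inter> a)" by blast
    show ?case unfolding eq by (rule sigma_sets.Compl[OF Compl.IH])
  next
    case (Union a)
    have eq: "Rn d \<inter> (\<Union>i. a i) = (\<Union>i. Rn d \<inter> a i)" by blast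
    show ?case unfolding eq by (rule sigma_sets.Union[OF Union.IH])
  qed
  moreover have "sets (borel :: (nat \<Rightarrow> real) measure) = sigma_sets UNIV {S. open S}"
    unfolding borel_def by (rule sets_measure_of) simp
  ultimately show ?thesis
    unfolding sets_restrict_space by (simp only: image_subset_iff) simp
qed

text \<open>The sets over which the integral of \<open>H\<close> vanishes form a Dynkin system that contains the cubes,
  which are closed under intersection. So the integral vanishes over the sets where \<open>H\<close>, or rather a Borel
  version of it, is positive or negative.\<close>

lemma integral_cubes_eq_0_imp_AE:
  fixes H :: "(nat \<Rightarrow> real) \<Rightarrow> real"
  assumes int: "integrable (leb d) H" and total: "integral\<^sup>L (leb d) H = 0"
    and cubes: "\<And>p q. (LINT x|leb d. indicator (cube d p q) x * H x) = 0"
  shows "AE x in leb d. H x = 0"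
proof -
  have "H \<in> borel_measurable (completion (leb_borel d))"
    using int unfolding leb_eq by simp
  then obtain G where G: "G \<in> borel_measurable (leb_borel d)" "AE x in leb_borel d. H x = G x"
    using completion_ex_borel_measurable_real by blast
  have ae: "AE x in leb d. H x = G x" using G(2) unfolding AE_leb_iff .
  have G_leb: "G \<in> borel_measurable (leb d)" using G(1) unfolding leb_eq by (rule measurable_completion)
  have intG: "integrable (leb d) G"
    using integrable_cong_AE[OF _ G_leb ae] int by auto
  have totalG: "integral\<^sup>L (leb d) G = 0"
    using integral_cong_AE[OF _ G_leb ae] total int by auto
  have cubesG: "(LINT x|leb d. indicator (cube d p q) x * G x) = 0" for p q
  proof -
    have "cube d p q \<in> sets (leb d)" by (rule sets_lebI[OF cube_in_borel_Rn])
    then have "(LINT x|leb d. indicator (cube d p q) x * G x) = (LINT x|leb d. indicator (cube d p q) x * H x)"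
      using ae int G_leb by (intro integral_cong_AE) auto
    then show ?thesis using cubes by simp
  qed
  have int_ind: "integrable (leb d) (\<lambda>x. indicator A x * G x)" if "A \<in> sets (borel_Rn d)" for A
    using integrable_mult_indicator[OF sets_lebI[OF that] intG] by simp
  have cubes_sets: "range (\<lambda>(p, q). cube d p q) \<subseteq> sets (borel_Rn d)"
    using cube_in_borel_Rn by auto
  have sp: "space (borel_Rn d) = Rn d" by (simp add: space_restrict_space)
  have sub: "sigma_sets (Rn d) (range (\<lambda>(p, q). cube d p q)) \<subseteq> sets (borel_Rn d)"
    using sets.sigma_sets_subset[OF cubes_sets] unfolding sp .
  have all: "(LINT x|leb d. indicator A x * G x) = 0" if "A \<in> sets (borel_Rn d)" for A
  proof -
    have A: "A \<in> sigma_sets (Rn d) (range (\<lambda>(p, q). cube d p q))"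
      using that sets_borel_Rn_subset by blast
    have stable: "Int_stable (range (\<lambda>(p, q). cube d p q))"
      unfolding Int_stable_def by (auto simp: cube_Int)
    have pow: "range (\<lambda>(p, q). cube d p q) \<subseteq> Pow (Rn d)"
      unfolding cube_def by auto
    from stable pow A show ?thesis
    proof (induction rule: sigma_sets_induct_disjoint)
      case (basic A)
      then show ?case using cubesG by auto
    next
      case empty
      then show ?case by simp
    next
      case (compl A)
      then have A: "A \<in> sets (borel_Rn d)" using sub by blast
      have "(LINT x|leb d. indicator (Rn d - A) x * G x) = (LINT x|leb d. G x - indicator A x * G x)"
        by (intro Bochner_Integration.integral_cong refl) (auto simp: space_leb indicator_def)
      also have "\<dots> = 0"
        using compl totalG intG int_ind[OF A] by simp
      finally show ?case .
    next
      case (union A)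
      then have A: "\<And>i. A i \<in> sets (leb d)" using sub sets_lebI by blast
      have disj: "disjoint_family A" using union by simp
      have "set_integrable (leb d) (\<Union>i. A i) G"
        unfolding set_integrable_def using integrable_mult_indicator[OF sets.countable_UN[OF _] intG] A by blast
      then have "(LINT x:(\<Union>i. A i)|leb d. G x) = (\<Sum>i. (LINT x:(A i)|leb d. G x))"
        using A disj by (intro lebesgue_integral_countable_add) (auto simp: disjoint_family_on_def)
      then show ?case using union by (simp add: set_lebesgue_integral_def)
    qed
  qed
  have sets_sign: "{x \<in> Rn d. G x > 0} \<in> sets (borel_Rn d)" "{x \<in> Rn d. G x < 0} \<in> sets (borel_Rn d)"
    using G(1) measurable_sets[of G "leb_borel d" borel "{0<..}"] measurable_sets[of G "leb_borel d" borel "{..<0}"]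
    by (simp_all add: vimage_def Int_def conj_commute)
  have pos: "AE x in leb d. indicator {x \<in> Rn d. G x > 0} x * G x = 0"
    using all[OF sets_sign(1)] integral_nonneg_eq_0_iff_AE[OF int_ind[OF sets_sign(1)]]
    by (auto simp: indicator_def)
  have neg: "AE x in leb d. - (indicator {x \<in> Rn d. G x < 0} x * G x) = 0"
    using all[OF sets_sign(2)] integral_nonneg_eq_0_iff_AE[OF integrable_minus[OF int_ind[OF sets_sign(2)]]]
    by (auto simp: indicator_def)
  show ?thesis
    using pos neg ae AE_space[of "leb d"]
    by eventually_elim (auto simp: indicator_def space_leb split: if_splits)
qed

text \<open>Products of bumps converge boundedly to indicators of cubes, so the hypothesis passes to the
  integrals of \<open>h\<close> over all cubes inside a fixed cube whose closure lies in \<open>\<Omega>\<close>.\<close>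

lemma fundamental_lemma:
  assumes \<Omega>: "openin (Euclidean_space d) \<Omega>" and h: "h \<in> L1_loc d \<Omega>"
    and test: "\<And>\<phi>. \<phi> \<in> test_functions d \<Omega> \<Longrightarrow> (LINT x|leb d. h x * \<phi> x) = 0"
  shows "AE x in leb d. x \<in> \<Omega> \<longrightarrow> h x = 0"
proof -
  have K_int: "integrable (leb d) (\<lambda>x. indicator (closed_cube d p q) x * h x)"
    if "closed_cube d p q \<subseteq> \<Omega>" for p q
  proof -
    have "compactin (Euclidean_space d) (closed_cube d p q)"
      unfolding compactin_Euclidean using compact_closed_cube by (auto simp: closed_cube_def)
    then show ?thesis using h that unfolding L1_loc_def set_integrable_def by auto
  qed
  have cube_int: "integrable (leb d) (\<lambda>x. indicator (cube d p q) x * h x)"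
    if "closed_cube d p q \<subseteq> \<Omega>" for p q
  proof -
    have "integrable (leb d) (\<lambda>x. indicator (cube d p q) x *\<^sub>R (indicator (closed_cube d p q) x * h x))"
      by (rule integrable_mult_indicator[OF sets_lebI[OF cube_in_borel_Rn] K_int[OF that]])
    also have "(\<lambda>x. indicator (cube d p q) x *\<^sub>R (indicator (closed_cube d p q) x * h x)) =
        (\<lambda>x. indicator (cube d p q) x * h x)"
      using cube_subset_closed_cube by (auto simp: indicator_def fun_eq_iff)
    finally show ?thesis .
  qed
  have cube_0: "(LINT x|leb d. indicator (cube d p q) x * h x) = 0"
    if sub: "closed_cube d p q \<subseteq> \<Omega>" for p q
  proof -
    let ?\<psi> = "\<lambda>n. coord_prod d (\<lambda>i. bump (p i) (q i) (real n))"
    have "(\<lambda>n. LINT x|leb d. h x * ?\<psi> n x) \<longlonglongrightarrow> (LINT x|leb d. indicator (cube d p q) x * h x)"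
    proof (rule integral_dominated_convergence[where w = "\<lambda>x. \<bar>indicator (closed_cube d p q) x * h x\<bar>"])
      show "(\<lambda>x. indicator (cube d p q) x * h x) \<in> borel_measurable (leb d)"
        using cube_int[OF sub] by simp
      show "(\<lambda>x. h x * ?\<psi> n x) \<in> borel_measurable (leb d)" for n
        using integrable_L1_loc_test[OF h bump_product_test_function[OF sub]] by simp
      show "integrable (leb d) (\<lambda>x. \<bar>indicator (closed_cube d p q) x * h x\<bar>)"
        using K_int[OF sub] by simp
      show "AE x in leb d. (\<lambda>n. h x * ?\<psi> n x) \<longlonglongrightarrow> indicator (cube d p q) x * h x"
      proof (rule AE_I2)
        fix x assume "x \<in> space (leb d)"
        then have "(\<lambda>n. h x * ?\<psi> n x) \<longlonglongrightarrow> h x * indicator (cube d p q) x"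
          by (intro tendsto_mult tendsto_const bump_product_tendsto) (simp add: space_leb)
        then show "(\<lambda>n. h x * ?\<psi> n x) \<longlonglongrightarrow> indicator (cube d p q) x * h x"
          by (simp only: mult.commute)
      qed
      show "AE x in leb d. norm (h x * ?\<psi> n x) \<le> \<bar>indicator (closed_cube d p q) x * h x\<bar>" for n
      proof (rule AE_I2)
        fix x assume "x \<in> space (leb d)"
        then have x: "x \<in> Rn d" by (simp add: space_leb)
        show "norm (h x * ?\<psi> n x) \<le> \<bar>indicator (closed_cube d p q) x * h x\<bar>"
        proof (cases "x \<in> closed_cube d p q")
          case True
          then show ?thesis
            using mult_left_mono[OF bump_product_bounds abs_ge_zero[of "h x"]] by (simp add: abs_mult)
        next
          case False
          then obtain i where "i < d" "x i \<notin> {p i<..<q i}"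
            using x by (force simp: closed_cube_def)
          then have "?\<psi> n x = 0"
            unfolding coord_prod_def by (intro prod_zero bexI[of _ i] bump_outside) auto
          then show ?thesis by simp
        qed
      qed
    qed
    moreover have "(LINT x|leb d. h x * ?\<psi> n x) = 0" for n
      by (rule test[OF bump_product_test_function[OF sub]])
    ultimately show ?thesis by (simp add: LIMSEQ_const_iff)
  qed
  have local: "AE x in leb d. indicator (cube d P Q) x * h x = 0" if sub: "closed_cube d P Q \<subseteq> \<Omega>" for P Q
  proof (rule integral_cubes_eq_0_imp_AE[OF cube_int[OF sub] cube_0[OF sub]])
    fix p q
    have "closed_cube d (\<lambda>i. max (p i) (P i)) (\<lambda>i. min (q i) (Q i)) \<subseteq> \<Omega>"
      using sub by (auto simp: closed_cube_def)
    from cube_0[OF this] show "(LINT x|leb d. indicator (cube d p q) x * (indicator (cube d P Q) x * h x)) = 0"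
      by (simp add: cube_Int[symmetric] indicator_inter_arith mult.assoc)
  qed
  obtain F where F: "countable F" "\<forall>(p, q)\<in>F. closed_cube d p q \<subseteq> \<Omega>" "\<Omega> = (\<Union>(p, q)\<in>F. cube d p q)"
    using open_countable_union_cubes[OF \<Omega>] by blast
  have "AE x in leb d. \<forall>r\<in>F. indicator (cube d (fst r) (snd r)) x * h x = 0"
    by (rule AE_ball_countable'[OF local F(1)]) (use F(2) in force)
  then show ?thesis
    by eventually_elim (use F(3) in \<open>force simp: indicator_def\<close>)
qed

section \<open>Square integrable functions, weak derivatives and bounded domains\<close>

definition sq_integrable :: "'a measure \<Rightarrow> ('a \<Rightarrow> real) \<Rightarrow> bool" where
  "sq_integrable M u \<longleftrightarrow> u \<in> borel_measurable M \<and> integrable M (\<lambda>x. (u x)\<^sup>2)"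

lemma sq_integrable_mult:
  assumes "sq_integrable M u" "sq_integrable M v"
  shows "integrable M (\<lambda>x. u x * v x)"
proof (rule Bochner_Integration.integrable_bound)
  show "integrable M (\<lambda>x. (u x)\<^sup>2 + (v x)\<^sup>2)"
    using assms by (auto simp: sq_integrable_def)
  show "(\<lambda>x. u x * v x) \<in> borel_measurable M"
    using assms by (auto simp: sq_integrable_def)
  have "\<bar>a * b\<bar> \<le> a\<^sup>2 + b\<^sup>2" for a b :: real
    using sum_squares_bound[of "\<bar>a\<bar>" "\<bar>b\<bar>"] mult_nonneg_nonneg[of "\<bar>a\<bar>" "\<bar>b\<bar>"]
    unfolding abs_mult power2_abs by linarith
  then show "AE x in M. norm (u x * v x) \<le> norm ((u x)\<^sup>2 + (v x)\<^sup>2)"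
    by simp
qed

lemma sq_integrable_lincomb:
  assumes "sq_integrable M u" "sq_integrable M v"
  shows "sq_integrable M (\<lambda>x. u x + c * v x)"
proof -
  have "integrable M (\<lambda>x. (u x)\<^sup>2 + 2 * c * (u x * v x) + c\<^sup>2 * (v x)\<^sup>2)"
    using assms sq_integrable_mult[OF assms] by (auto simp: sq_integrable_def)
  moreover have "(\<lambda>x. u x + c * v x) \<in> borel_measurable M"
    using assms by (auto simp: sq_integrable_def)
  ultimately show ?thesis
    by (simp add: sq_integrable_def power2_eq_square algebra_simps)
qed

lemma sq_integrable_diff:
  "sq_integrable M u \<Longrightarrow> sq_integrable M v \<Longrightarrow> sq_integrable M (\<lambda>x. u x - v x)"
  using sq_integrable_lincomb[of M u v "-1"] by simp

lemma sq_integrable_add: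
  "sq_integrable M u \<Longrightarrow> sq_integrable M v \<Longrightarrow> sq_integrable M (\<lambda>x. u x + v x)"
  using sq_integrable_lincomb[of M u v 1] by simp

lemma sq_integrable_abs: "sq_integrable M u \<Longrightarrow> sq_integrable M (\<lambda>x. \<bar>u x\<bar>)"
  by (auto simp: sq_integrable_def)

lemma (in finite_measure) sq_integrable_bounded:
  assumes "u \<in> borel_measurable M" "\<And>x. x \<in> space M \<Longrightarrow> \<bar>u x\<bar> \<le> C"
  shows "sq_integrable M u"
proof -
  have "integrable M (\<lambda>x. (u x)\<^sup>2)"
  proof (rule integrable_const_bound[where B = "C\<^sup>2"])
    show "AE x in M. norm ((u x)\<^sup>2) \<le> C\<^sup>2"
      using assms(2) by (auto intro!: AE_I2 abs_le_square_iff[THEN iffD1] intro: order_trans[OF _ abs_ge_self])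
  qed (use assms(1) in auto)
  then show ?thesis using assms(1) by (simp add: sq_integrable_def)
qed

lemma (in finite_measure) sq_integrable_imp_integrable:
  assumes "sq_integrable M u" shows "integrable M u"
  using sq_integrable_mult[OF assms sq_integrable_bounded[of "\<lambda>_. 1" 1]] by simp

text \<open>Young's inequality with a weight, optimized against \<open>\<epsilon>\<close>, does the work of the Cauchy-Schwarz
  inequality.\<close>

lemma L2_limit_pairing:
  assumes e: "\<And>n. sq_integrable M (e n)" and w: "sq_integrable M w"
    and lim: "(\<lambda>n. LINT x|M. (e n x)\<^sup>2) \<longlonglongrightarrow> 0"
  shows "(\<lambda>n. LINT x|M. \<bar>e n x\<bar> * \<bar>w x\<bar>) \<longlonglongrightarrow> 0"
proof (rule tendstoI)
  fix \<epsilon> :: real assume \<epsilon>: "\<epsilon> > 0"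
  define W where "W = (LINT x|M. (w x)\<^sup>2)"
  have W: "W \<ge> 0" unfolding W_def by (rule integral_nonneg_AE) simp
  \<comment> \<open>The weight is chosen so that half of it times the fixed integral \<open>W\<close> costs at most half of \<open>\<epsilon>\<close>.\<close>
  define \<delta> where "\<delta> = \<epsilon> / (W + 1)"
  have \<delta>: "\<delta> > 0" using \<epsilon> W by (simp add: \<delta>_def)
  have "\<delta> * W \<le> \<epsilon>" using \<epsilon> W by (simp add: \<delta>_def field_simps)
  have young: "\<bar>a\<bar> * \<bar>b\<bar> \<le> (1 / (2 * \<delta>)) * a\<^sup>2 + (\<delta> / 2) * b\<^sup>2" for a b :: real
  proof -
    have "0 \<le> (\<bar>a\<bar> - \<delta> * \<bar>b\<bar>)\<^sup>2" by simp
    then have "2 * \<delta> * (\<bar>a\<bar> * \<bar>b\<bar>) \<le> a\<^sup>2 + \<delta>\<^sup>2 * b\<^sup>2"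
      by (simp add: power2_diff power_mult_distrib algebra_simps)
    then show ?thesis using \<delta> by (simp add: field_simps power2_eq_square)
  qed
  have "eventually (\<lambda>n. (LINT x|M. (e n x)\<^sup>2) < \<epsilon> * \<delta>) sequentially"
    using order_tendstoD(2)[OF lim, of "\<epsilon> * \<delta>"] \<epsilon> \<delta> by simp
  then show "eventually (\<lambda>n. dist (LINT x|M. \<bar>e n x\<bar> * \<bar>w x\<bar>) 0 < \<epsilon>) sequentially"
  proof eventually_elim
    case (elim n)
    have int: "integrable M (\<lambda>x. (e n x)\<^sup>2)" "integrable M (\<lambda>x. (w x)\<^sup>2)"
      using e[of n] w by (auto simp: sq_integrable_def)
    have "(LINT x|M. \<bar>e n x\<bar> * \<bar>w x\<bar>) \<le> (LINT x|M. (1 / (2 * \<delta>)) * (e n x)\<^sup>2 + (\<delta> / 2) * (w x)\<^sup>2)"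
      using int sq_integrable_mult[OF sq_integrable_abs[OF e] sq_integrable_abs[OF w]] young
      by (intro integral_mono) auto
    also have "\<dots> = (1 / (2 * \<delta>)) * (LINT x|M. (e n x)\<^sup>2) + (\<delta> / 2) * W"
      using int by (simp add: W_def)
    also have "\<dots> < (1 / (2 * \<delta>)) * (\<epsilon> * \<delta>) + (\<delta> / 2) * W"
      using elim \<delta> by (intro add_strict_right_mono mult_strict_left_mono) auto
    also have "\<dots> \<le> \<epsilon>" using \<delta> \<open>\<delta> * W \<le> \<epsilon>\<close> by simp
    finally have "(LINT x|M. \<bar>e n x\<bar> * \<bar>w x\<bar>) < \<epsilon>" .
    moreover have "0 \<le> (LINT x|M. \<bar>e n x\<bar> * \<bar>w x\<bar>)"
      by (rule integral_nonneg_AE) simp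
    ultimately show ?case by simp
  qed
qed

lemma integral_tendsto_dominated_error:
  fixes g :: "nat \<Rightarrow> 'a \<Rightarrow> real"
  assumes "\<And>n. integrable M (g n)" "integrable M g0" "\<And>n. integrable M (a n)"
    and "\<And>n x. x \<in> space M \<Longrightarrow> \<bar>g n x - g0 x\<bar> \<le> a n x"
    and "(\<lambda>n. integral\<^sup>L M (a n)) \<longlonglongrightarrow> 0"
  shows "(\<lambda>n. integral\<^sup>L M (g n)) \<longlonglongrightarrow> integral\<^sup>L M g0"
proof -
  have "\<bar>integral\<^sup>L M (g n) - integral\<^sup>L M g0\<bar> \<le> integral\<^sup>L M (a n)" for n
  proof -
    have "integral\<^sup>L M (g n) - integral\<^sup>L M g0 = (LINT x|M. g n x - g0 x)"
      using assms(1,2) by simp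
    also have "\<bar>\<dots>\<bar> \<le> (LINT x|M. \<bar>g n x - g0 x\<bar>)"
      by (rule integral_abs_bound)
    also have "\<dots> \<le> integral\<^sup>L M (a n)"
      using assms by (intro integral_mono) auto
    finally show ?thesis .
  qed
  then have "(\<lambda>n. integral\<^sup>L M (g n) - integral\<^sup>L M g0) \<longlonglongrightarrow> 0"
    by (intro Lim_null_comparison[OF _ assms(5)]) auto
  then show ?thesis by (simp add: LIM_zero_iff)
qed

lemma L1_loc_lincomb:
  assumes "u \<in> L1_loc d \<Omega>" "v \<in> L1_loc d \<Omega>"
  shows "(\<lambda>x. u x + c * v x) \<in> L1_loc d \<Omega>"
  using assms unfolding L1_loc_def by (auto intro!: set_integral_add(1) set_integrable_mult_right)

lemma has_weak_deriv_lincomb: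
  assumes u: "has_weak_deriv d \<Omega> \<alpha> u g" and v: "has_weak_deriv d \<Omega> \<alpha> v h" and \<alpha>: "set \<alpha> \<subseteq> {..<d}"
  shows "has_weak_deriv d \<Omega> \<alpha> (\<lambda>x. u x + c * v x) (\<lambda>x. g x + c * h x)"
proof -
  have loc: "u \<in> L1_loc d \<Omega>" "g \<in> L1_loc d \<Omega>" "v \<in> L1_loc d \<Omega>" "h \<in> L1_loc d \<Omega>"
    using u v by (auto simp: has_weak_deriv_def)
  have lin: "(LINT x|leb d. (a x + c * b x) * \<psi> x) = (LINT x|leb d. a x * \<psi> x) + c * (LINT x|leb d. b x * \<psi> x)"
    if "a \<in> L1_loc d \<Omega>" "b \<in> L1_loc d \<Omega>" "\<psi> \<in> test_functions d \<Omega>" for a b \<psi>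
  proof -
    have "(LINT x|leb d. (a x + c * b x) * \<psi> x) = (LINT x|leb d. a x * \<psi> x + c * (b x * \<psi> x))"
      by (simp add: algebra_simps)
    also have "\<dots> = (LINT x|leb d. a x * \<psi> x) + c * (LINT x|leb d. b x * \<psi> x)"
      using integrable_L1_loc_test[OF that(1,3)] integrable_L1_loc_test[OF that(2,3)] by simp
    finally show ?thesis .
  qed
  show ?thesis
    unfolding has_weak_deriv_def
  proof (intro conjI ballI L1_loc_lincomb loc)
    fix \<phi> assume \<phi>: "\<phi> \<in> test_functions d \<Omega>"
    note \<psi> = test_functions_partials[OF \<phi> \<alpha>]
    have *: "(LINT x|leb d. a x * partials \<alpha> \<phi> x) = (- 1) ^ length \<alpha> * (LINT x|leb d. b x * \<phi> x)"
      if "has_weak_deriv d \<Omega> \<alpha> a b" for a b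
      using that \<phi> unfolding has_weak_deriv_def set_integral_test[OF \<phi>, symmetric] set_integral_test[OF \<psi>, symmetric]
      by blast
    show "(LINT x:\<Omega>|leb d. (u x + c * v x) * partials \<alpha> \<phi> x) =
        (- 1) ^ length \<alpha> * (LINT x:\<Omega>|leb d. (g x + c * h x) * \<phi> x)"
      unfolding set_integral_test[OF \<phi>] set_integral_test[OF \<psi>] lin[OF loc(1,3) \<psi>] lin[OF loc(2,4) \<phi>]
        *[OF u] *[OF v] by (simp add: algebra_simps)
  qed
qed

lemma has_weak_deriv_unique:
  assumes \<Omega>: "openin (Euclidean_space d) \<Omega>"
    and g: "has_weak_deriv d \<Omega> \<alpha> u g" and h: "has_weak_deriv d \<Omega> \<alpha> u h"
  shows "AE x in leb d. x \<in> \<Omega> \<longrightarrow> g x = h x"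
proof -
  have loc: "g \<in> L1_loc d \<Omega>" "h \<in> L1_loc d \<Omega>"
    using g h by (auto simp: has_weak_deriv_def)
  have "AE x in leb d. x \<in> \<Omega> \<longrightarrow> g x + (- 1) * h x = 0"
  proof (rule fundamental_lemma[OF \<Omega> L1_loc_lincomb[OF loc]])
    fix \<phi> assume \<phi>: "\<phi> \<in> test_functions d \<Omega>"
    have "(LINT x:\<Omega>|leb d. u x * partials \<alpha> \<phi> x) = (- 1) ^ length \<alpha> * (LINT x:\<Omega>|leb d. g x * \<phi> x)"
      using g \<phi> unfolding has_weak_deriv_def by blast
    moreover have "(LINT x:\<Omega>|leb d. u x * partials \<alpha> \<phi> x) = (- 1) ^ length \<alpha> * (LINT x:\<Omega>|leb d. h x * \<phi> x)"
      using h \<phi> unfolding has_weak_deriv_def by blast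
    ultimately have "(LINT x|leb d. g x * \<phi> x) = (LINT x|leb d. h x * \<phi> x)"
      by (simp add: set_integral_test[OF \<phi>])
    moreover have "(LINT x|leb d. (g x + (- 1) * h x) * \<phi> x) = (LINT x|leb d. g x * \<phi> x) - (LINT x|leb d. h x * \<phi> x)"
      using integrable_L1_loc_test[OF loc(1) \<phi>] integrable_L1_loc_test[OF loc(2) \<phi>]
      by (simp add: algebra_simps)
    ultimately show "(LINT x|leb d. (g x + (- 1) * h x) * \<phi> x) = 0" by simp
  qed
  then show ?thesis by eventually_elim auto
qed

lemma weak_deriv_AE_eq:
  assumes "openin (Euclidean_space d) \<Omega>" "has_weak_deriv d \<Omega> \<alpha> u g"
  shows "AE x in leb d. x \<in> \<Omega> \<longrightarrow> weak_deriv d \<Omega> \<alpha> u x = g x"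
proof (rule has_weak_deriv_unique[OF assms(1) _ assms(2)])
  show "has_weak_deriv d \<Omega> \<alpha> u (weak_deriv d \<Omega> \<alpha> u)"
    unfolding weak_deriv_def by (rule someI[of "has_weak_deriv d \<Omega> \<alpha> u"]) (rule assms(2))
qed

text \<open>With respect to this measure, set integrals over \<open>\<Omega>\<close> become integrals and the general theory of
  finite measures applies.\<close>

definition leb_on :: "nat \<Rightarrow> (nat \<Rightarrow> real) set \<Rightarrow> (nat \<Rightarrow> real) measure" where
  "leb_on d \<Omega> = restrict_space (leb d) \<Omega>"

locale bounded_domain =
  fixes d :: nat and \<Omega> :: "(nat \<Rightarrow> real) set"
  assumes open_\<Omega>: "openin (Euclidean_space d) \<Omega>" and bounded_\<Omega>: "bounded_in_Rn d \<Omega>"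
begin

lemma \<Omega>_subset: "\<Omega> \<subseteq> Rn d"
  using openin_subset[OF open_\<Omega>] .

lemma \<Omega>_sets: "\<Omega> \<inter> space (leb d) \<in> sets (leb d)"
  using openin_in_sets_leb[OF open_\<Omega>] \<Omega>_subset by (simp add: space_leb Int_absorb2)

lemma space_leb_on: "space (leb_on d \<Omega>) = \<Omega>"
  unfolding leb_on_def space_restrict_space space_leb using \<Omega>_subset by blast

lemma measure_leb_on: "A \<subseteq> \<Omega> \<Longrightarrow> measure (leb_on d \<Omega>) A = measure (leb d) A"
  unfolding leb_on_def by (rule measure_restrict_space[OF \<Omega>_sets])

lemma emeasure_\<Omega>_finite: "emeasure (leb d) \<Omega> < \<infinity>"
proof -
  obtain B where "\<forall>x\<in>\<Omega>. \<forall>i<d. \<bar>x i\<bar> \<le> B"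
    using bounded_in_Rn_coordinates[OF bounded_\<Omega>] by blast
  then show ?thesis using emeasure_leb_finite[of \<Omega> d B] \<Omega>_subset by simp
qed

sublocale finite_measure "leb_on d \<Omega>"
proof (rule finite_measureI)
  have "emeasure (leb_on d \<Omega>) \<Omega> = emeasure (leb d) \<Omega>"
    unfolding leb_on_def by (rule emeasure_restrict_space[OF \<Omega>_sets]) simp
  then show "emeasure (leb_on d \<Omega>) (space (leb_on d \<Omega>)) \<noteq> \<infinity>"
    unfolding space_leb_on using emeasure_\<Omega>_finite by auto
qed

lemma set_integral_leb_on: "(LINT x:\<Omega>|leb d. f x) = (LINT x|leb_on d \<Omega>. f x)"
  for f :: "_ \<Rightarrow> real"
  unfolding set_lebesgue_integral_def leb_on_def by (rule integral_restrict_space[OF \<Omega>_sets, symmetric])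

lemma set_integrable_leb_on: "set_integrable (leb d) \<Omega> f \<longleftrightarrow> integrable (leb_on d \<Omega>) f"
  for f :: "_ \<Rightarrow> real"
  unfolding set_integrable_def leb_on_def by (rule integrable_restrict_space[OF \<Omega>_sets, symmetric])

lemma AE_leb_on_iff: "(AE x in leb_on d \<Omega>. P x) \<longleftrightarrow> (AE x in leb d. x \<in> \<Omega> \<longrightarrow> P x)"
  unfolding leb_on_def by (rule AE_restrict_space_iff[OF \<Omega>_sets])

lemma L2_iff: "u \<in> L2 d \<Omega> \<longleftrightarrow> sq_integrable (leb_on d \<Omega>) u"
  unfolding L2_def sq_integrable_def mem_Collect_eq set_integrable_leb_on
  unfolding set_borel_measurable_def leb_on_def borel_measurable_restrict_space_iff[OF \<Omega>_sets] ..

lemma leb_on_measurableI: "f \<in> borel_measurable (leb d) \<Longrightarrow> f \<in> borel_measurable (leb_on d \<Omega>)"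
  unfolding leb_on_def by (rule measurable_restrict_space1)

lemma continuous_bounded:
  fixes f :: "(nat \<Rightarrow> real) \<Rightarrow> real"
  assumes "continuous_on (Rn d) f"
  shows "\<exists>C\<ge>0. \<forall>x\<in>\<Omega>. \<bar>f x\<bar> \<le> C"
proof -
  obtain B where B: "\<forall>x\<in>\<Omega>. \<forall>i<d. \<bar>x i\<bar> \<le> B"
    using bounded_in_Rn_coordinates[OF bounded_\<Omega>] by blast
  have sub: "\<Omega> \<subseteq> closed_cube d (\<lambda>_. - B) (\<lambda>_. B)"
    using B \<Omega>_subset by (force simp: closed_cube_def)
  have "closed_cube d (\<lambda>_. - B) (\<lambda>_. B) \<subseteq> Rn d" by (auto simp: closed_cube_def)
  from continuous_bounded_on_compact[OF assms compact_closed_cube this] show ?thesis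
    using sub by blast
qed

lemma continuous_sq_integrable:
  assumes "continuous_on (Rn d) f" shows "sq_integrable (leb_on d \<Omega>) f"
proof -
  obtain C where "\<forall>x\<in>\<Omega>. \<bar>f x\<bar> \<le> C" using continuous_bounded[OF assms] by blast
  then show ?thesis
    by (intro sq_integrable_bounded[where C = C] leb_on_measurableI continuous_measurable_leb assms)
      (simp add: space_leb_on)
qed

lemma integrable_in_L1_loc:
  assumes "integrable (leb_on d \<Omega>) h" shows "h \<in> L1_loc d \<Omega>"
  unfolding L1_loc_def compactin_Euclidean
proof (intro CollectI allI impI)
  fix K assume K: "(compact K \<and> K \<subseteq> Rn d) \<and> K \<subseteq> \<Omega>"
  show "set_integrable (leb d) K h"
    by (rule set_integrable_subset[of _ \<Omega>])
      (use K assms compact_in_sets_leb in \<open>auto simp: set_integrable_leb_on\<close>)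
qed

lemma integral_test_leb_on:
  assumes "\<phi> \<in> test_functions d \<Omega>"
  shows "(LINT x|leb d. u x * \<phi> x) = (LINT x|leb_on d \<Omega>. u x * \<phi> x)"
  using set_integral_test[OF assms, of u] by (simp add: set_integral_leb_on)

lemma weak_deriv_AE:
  assumes "has_weak_deriv d \<Omega> \<alpha> u g"
  shows "AE x in leb_on d \<Omega>. weak_deriv d \<Omega> \<alpha> u x = g x"
  unfolding AE_leb_on_iff by (rule weak_deriv_AE_eq[OF open_\<Omega> assms])

end

section \<open>Derivatives vanish on zero sets\<close>

lemma arctan_lipschitz: "\<bar>arctan a - arctan b\<bar> \<le> \<bar>a - b\<bar>" for a b :: real
proof -
  have *: "\<bar>arctan a - arctan b\<bar> \<le> \<bar>a - b\<bar>" if lt: "a < b" for a b :: real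
  proof -
    obtain z where z: "arctan b - arctan a = (b - a) * inverse (1 + z\<^sup>2)"
      using MVT2[OF lt, of arctan "\<lambda>z. inverse (1 + z\<^sup>2)"] DERIV_arctan by blast
    have "inverse (1 + z\<^sup>2) \<le> 1" by (simp add: inverse_le_1_iff add_pos_nonneg)
    then have "(b - a) * inverse (1 + z\<^sup>2) \<le> b - a" using lt by (simp add: mult_left_le)
    then show ?thesis using z lt by (simp add: arctan_less_iff less_imp_le abs_of_neg)
  qed
  show ?thesis using *[of a b] *[of b a] by (cases a b rule: linorder_cases) (auto simp: abs_minus_commute)
qed

text \<open>The derivative of \<open>s \<mapsto> arctan (m s) / m\<close>. As \<open>m\<close> grows it tends to the indicator of \<open>{0}\<close>, while
  \<open>arctan (m s) / m\<close> tends to zero uniformly.\<close>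

definition damp :: "real \<Rightarrow> real \<Rightarrow> real" where
  "damp m s = 1 / (1 + (m * s)\<^sup>2)"

lemma damp_bounds: "0 \<le> damp m s" "damp m s \<le> 1"
  by (auto simp: damp_def add_pos_nonneg)

lemma damp_lipschitz: "\<bar>damp m s - damp m t\<bar> \<le> \<bar>m\<bar> * \<bar>s - t\<bar>"
proof -
  define a b where "a = m * s" and "b = m * t"
  have pos: "1 + a\<^sup>2 > 0" "1 + b\<^sup>2 > 0" by (auto simp: add_pos_nonneg)
  have amgm: "2 * \<bar>x\<bar> \<le> 1 + x\<^sup>2" for x :: real
    using sum_squares_bound[of 1 "\<bar>x\<bar>"] by simp
  have "\<bar>a + b\<bar> \<le> (1 + a\<^sup>2) * (1 + b\<^sup>2)"
  proof -
    have "(1 + a\<^sup>2) * (1 + b\<^sup>2) = 1 + a\<^sup>2 + b\<^sup>2 + a\<^sup>2 * b\<^sup>2" by (simp add: algebra_simps)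
    moreover have "0 \<le> a\<^sup>2 * b\<^sup>2" by simp
    ultimately show ?thesis
      using amgm[of a] amgm[of b] abs_triangle_ineq[of a b] zero_le_power2[of a] zero_le_power2[of b] by linarith
  qed
  then have "\<bar>a - b\<bar> * \<bar>a + b\<bar> \<le> \<bar>a - b\<bar> * ((1 + a\<^sup>2) * (1 + b\<^sup>2))"
    by (intro mult_left_mono) auto
  moreover have "damp m s - damp m t = (b - a) * (a + b) / ((1 + a\<^sup>2) * (1 + b\<^sup>2))"
    using pos unfolding damp_def a_def[symmetric] b_def[symmetric]
    by (simp add: diff_frac_eq power2_eq_square algebra_simps)
  moreover have "\<bar>(b - a) * (a + b) / ((1 + a\<^sup>2) * (1 + b\<^sup>2))\<bar> = \<bar>a - b\<bar> * \<bar>a + b\<bar> / ((1 + a\<^sup>2) * (1 + b\<^sup>2))"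
    using pos by (simp add: abs_mult abs_minus_commute)
  ultimately have "\<bar>damp m s - damp m t\<bar> \<le> \<bar>a - b\<bar>"
    using pos by (simp add: divide_le_eq)
  also have "\<bar>a - b\<bar> = \<bar>m\<bar> * \<bar>s - t\<bar>"
    by (simp add: a_def b_def abs_mult[symmetric] right_diff_distrib)
  finally show ?thesis .
qed

lemma damp_tendsto: "(\<lambda>k. damp (real (Suc k)) s) \<longlonglongrightarrow> (if s = 0 then 1 else 0)"
proof (cases "s = 0")
  case False
  have "filterlim (\<lambda>k. s\<^sup>2 * real k) at_top sequentially"
    by (rule filterlim_tendsto_pos_mult_at_top[OF tendsto_const _ filterlim_real_sequentially]) (use False in simp)
  then have "filterlim (\<lambda>k. 1 + (real (Suc k) * s)\<^sup>2) at_top sequentially"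
  proof (rule filterlim_at_top_mono, intro always_eventually allI)
    fix k
    have "real k \<le> (real (Suc k))\<^sup>2" by (simp add: power2_eq_square algebra_simps)
    then have "s\<^sup>2 * real k \<le> s\<^sup>2 * (real (Suc k))\<^sup>2" by (intro mult_left_mono) auto
    then show "s\<^sup>2 * real k \<le> 1 + (real (Suc k) * s)\<^sup>2"
      by (simp add: power_mult_distrib mult.commute)
  qed
  then have "(\<lambda>k. inverse (1 + (real (Suc k) * s)\<^sup>2)) \<longlonglongrightarrow> 0"
    by (rule tendsto_inverse_0_at_top)
  then show ?thesis using False by (simp add: damp_def inverse_eq_divide)
qed (simp add: damp_def)

lemma has_partial_arctan:
  assumes "has_partial d i f f'" "m > 0"
  shows "has_partial d i (\<lambda>x. arctan (m * f x) / m) (\<lambda>x. damp m (f x) * f' x)"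
  unfolding has_partial_def
proof (intro ballI allI)
  fix x t assume "x \<in> Rn d"
  then have "((\<lambda>s. f (x(i := s))) has_real_derivative f' (x(i := t))) (at t)"
    using assms(1) unfolding has_partial_def by blast
  then have "((\<lambda>s. m * f (x(i := s))) has_real_derivative m * f' (x(i := t))) (at t)"
    by (rule DERIV_cmult)
  from DERIV_cdivide[OF DERIV_chain2[OF DERIV_arctan this], of m]
  show "((\<lambda>s. arctan (m * f (x(i := s))) / m) has_real_derivative damp m (f (x(i := t))) * f' (x(i := t))) (at t)"
    by (rule DERIV_cong) (use assms(2) in \<open>simp add: damp_def inverse_eq_divide\<close>)
qed

lemma sq_integrable_mult_bounded:
  assumes "sq_integrable M u" "v \<in> borel_measurable M" "\<And>x. x \<in> space M \<Longrightarrow> \<bar>v x\<bar> \<le> C"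
  shows "sq_integrable M (\<lambda>x. u x * v x)"
proof -
  have "integrable M (\<lambda>x. (u x)\<^sup>2 * (v x)\<^sup>2)"
  proof (rule integrable_mult_bounded[where C = "C\<^sup>2"])
    show "\<bar>(v x)\<^sup>2\<bar> \<le> C\<^sup>2" if "x \<in> space M" for x
      using assms(3)[OF that] power_mono[OF assms(3)[OF that] abs_ge_zero, of 2] by simp
  qed (use assms in \<open>auto simp: sq_integrable_def\<close>)
  then show ?thesis
    using assms by (auto simp: sq_integrable_def power_mult_distrib)
qed

context bounded_domain
begin

text \<open>The chain rule for \<open>arctan (m u) / m\<close>, tested against \<open>\<phi>\<close>. It holds classically for the
  approximations. Both sides pass to the limit because \<open>arctan\<close> and \<open>damp m\<close> are bounded and Lipschitz.\<close>

lemma truncated_integration_by_parts: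
  assumes i: "i < d" and m: "m > 0" and \<phi>: "\<phi> \<in> test_functions d \<Omega>"
    and f: "\<And>n. has_partial d i (f n) (f' n)" "\<And>n. continuous_on (Rn d) (f n)" "\<And>n. continuous_on (Rn d) (f' n)"
    and u: "sq_integrable (leb_on d \<Omega>) u" and h: "sq_integrable (leb_on d \<Omega>) h"
    and lim_u: "(\<lambda>n. LINT x|leb_on d \<Omega>. (f n x - u x)\<^sup>2) \<longlonglongrightarrow> 0"
    and lim_h: "(\<lambda>n. LINT x|leb_on d \<Omega>. (f' n x - h x)\<^sup>2) \<longlonglongrightarrow> 0"
  shows "(LINT x|leb_on d \<Omega>. (arctan (m * u x) / m) * partial i \<phi> x) =
    - (LINT x|leb_on d \<Omega>. (damp m (u x) * h x) * \<phi> x)"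
proof -
  let ?M = "leb_on d \<Omega>"
  have cont: "continuous_on (Rn d) \<phi>" "continuous_on (Rn d) (partial i \<phi>)"
    using \<phi> test_functions_partial[OF \<phi> i] smooth_continuous unfolding test_functions_iff by blast+
  have sq: "sq_integrable ?M \<phi>" "sq_integrable ?M (partial i \<phi>)" "sq_integrable ?M (f n)" "sq_integrable ?M (f' n)" for n
    by (rule continuous_sq_integrable cont f)+
  obtain C where C: "\<forall>x\<in>\<Omega>. \<bar>\<phi> x\<bar> \<le> C"
    using continuous_bounded[OF cont(1)] by blast
  have meas: "u \<in> borel_measurable ?M" "h \<in> borel_measurable ?M" "\<phi> \<in> borel_measurable ?M"
    "f n \<in> borel_measurable ?M" "f' n \<in> borel_measurable ?M" for n
    using u h sq by (auto simp: sq_integrable_def)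
  have arctan_sq: "sq_integrable ?M (\<lambda>x. arctan (m * g x) / m)" if "g \<in> borel_measurable ?M" for g
  proof (rule sq_integrable_bounded[where C = "2 / m"])
    show "(\<lambda>x. arctan (m * g x) / m) \<in> borel_measurable ?M"
      using that by (intro borel_measurable_divide borel_measurable_const
        measurable_compose[OF _ borel_measurable_continuous_onI[OF continuous_on_arctan[OF continuous_on_id]]]) auto
    have "\<bar>arctan y\<bar> \<le> 2" for y :: real
      using arctan_lbound[of y] arctan_ubound[of y] pi_less_4 by (auto simp: abs_le_iff)
    then show "\<bar>arctan (m * g x) / m\<bar> \<le> 2 / m" for x
      using m by (simp add: divide_right_mono)
  qed
  have damp_int: "integrable ?M (\<lambda>x. (damp m (g x) * k x) * \<phi> x)"
    if "g \<in> borel_measurable ?M" "sq_integrable ?M k" for g k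
  proof -
    have "integrable ?M (\<lambda>x. (k x * \<phi> x) * damp m (g x))"
    proof (rule integrable_mult_bounded[OF sq_integrable_mult[OF that(2) sq(1)], where C = 1])
      show "(\<lambda>x. damp m (g x)) \<in> borel_measurable ?M"
        unfolding damp_def using that by simp
      show "\<bar>damp m (g x)\<bar> \<le> 1" for x
        using damp_bounds[of m "g x"] by simp
    qed
    then show ?thesis by (simp add: mult_ac)
  qed
  have parts: "(LINT x|?M. (arctan (m * f n x) / m) * partial i \<phi> x) =
      - (LINT x|?M. (damp m (f n x) * f' n x) * \<phi> x)" for n
    unfolding integral_test_leb_on[OF \<phi>, symmetric] integral_test_leb_on[OF test_functions_partial[OF \<phi> i], symmetric]
  proof (rule integration_by_parts[OF has_partial_arctan[OF f(1) m] _ _ \<phi> i])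
    show "continuous_on (Rn d) (\<lambda>x. arctan (m * f n x) / m)"
      using m by (intro continuous_intros f) auto
    show "continuous_on (Rn d) (\<lambda>x. damp m (f n x) * f' n x)"
      unfolding damp_def by (intro continuous_intros f) (auto simp: add_nonneg_eq_0_iff)
  qed
  have "(\<lambda>n. LINT x|?M. (arctan (m * f n x) / m) * partial i \<phi> x) \<longlonglongrightarrow>
      (LINT x|?M. (arctan (m * u x) / m) * partial i \<phi> x)"
  proof (rule integral_tendsto_dominated_error[where a = "\<lambda>n x. \<bar>f n x - u x\<bar> * \<bar>partial i \<phi> x\<bar>"])
    show "(\<lambda>n. LINT x|?M. \<bar>f n x - u x\<bar> * \<bar>partial i \<phi> x\<bar>) \<longlonglongrightarrow> 0"
      by (rule L2_limit_pairing[OF sq_integrable_diff[OF sq(3) u] sq(2) lim_u])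
    fix n x
    have "\<bar>arctan (m * f n x) / m - arctan (m * u x) / m\<bar> \<le> \<bar>f n x - u x\<bar>"
    proof -
      have "\<bar>m * f n x - m * u x\<bar> = m * \<bar>f n x - u x\<bar>"
        using m by (simp add: right_diff_distrib[symmetric] abs_mult)
      then show ?thesis
        using arctan_lipschitz[of "m * f n x" "m * u x"] m
        by (simp add: diff_divide_distrib[symmetric] divide_le_eq mult.commute)
    qed
    then have "\<bar>arctan (m * f n x) / m - arctan (m * u x) / m\<bar> * \<bar>partial i \<phi> x\<bar> \<le> \<bar>f n x - u x\<bar> * \<bar>partial i \<phi> x\<bar>"
      by (rule mult_right_mono) simp
    then show "\<bar>(arctan (m * f n x) / m) * partial i \<phi> x - (arctan (m * u x) / m) * partial i \<phi> x\<bar>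
        \<le> \<bar>f n x - u x\<bar> * \<bar>partial i \<phi> x\<bar>"
      by (simp only: abs_mult[symmetric] left_diff_distrib)
  qed (intro sq_integrable_mult arctan_sq meas sq sq_integrable_abs sq_integrable_diff u)+
  moreover have "(\<lambda>n. LINT x|?M. (damp m (f n x) * f' n x) * \<phi> x) \<longlonglongrightarrow>
      (LINT x|?M. (damp m (u x) * h x) * \<phi> x)"
  proof (rule integral_tendsto_dominated_error[where
        a = "\<lambda>n x. \<bar>f' n x - h x\<bar> * \<bar>\<phi> x\<bar> + m * (\<bar>f n x - u x\<bar> * \<bar>h x * \<phi> x\<bar>)"])
    have h\<phi>: "sq_integrable ?M (\<lambda>x. h x * \<phi> x)"
      by (rule sq_integrable_mult_bounded[OF h meas(3), where C = C]) (use C in \<open>simp add: space_leb_on\<close>)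
    have int: "integrable ?M (\<lambda>x. \<bar>f' n x - h x\<bar> * \<bar>\<phi> x\<bar>)" "integrable ?M (\<lambda>x. \<bar>f n x - u x\<bar> * \<bar>h x * \<phi> x\<bar>)" for n
      by (intro sq_integrable_mult sq_integrable_abs sq_integrable_diff sq u h h\<phi>)+
    then show "integrable ?M (\<lambda>x. \<bar>f' n x - h x\<bar> * \<bar>\<phi> x\<bar> + m * (\<bar>f n x - u x\<bar> * \<bar>h x * \<phi> x\<bar>))" for n
      by (intro Bochner_Integration.integrable_add Bochner_Integration.integrable_mult_right)
    have "(\<lambda>n. (LINT x|?M. \<bar>f' n x - h x\<bar> * \<bar>\<phi> x\<bar>) + m * (LINT x|?M. \<bar>f n x - u x\<bar> * \<bar>h x * \<phi> x\<bar>))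
        \<longlonglongrightarrow> 0 + m * 0"
      by (intro tendsto_intros L2_limit_pairing sq_integrable_diff sq u h h\<phi> lim_u lim_h)
    then show "(\<lambda>n. LINT x|?M. \<bar>f' n x - h x\<bar> * \<bar>\<phi> x\<bar> + m * (\<bar>f n x - u x\<bar> * \<bar>h x * \<phi> x\<bar>)) \<longlonglongrightarrow> 0"
      using int by simp
    fix n x
    \<comment> \<open>The factor that only converges in \<open>L\<^sup>2\<close> is paired with the bounded \<open>damp\<close> of the approximation,
      the Lipschitz difference of the \<open>damp\<close> factors with the fixed function \<open>h\<close>.\<close>
    have "(damp m (f n x) * f' n x) * \<phi> x - (damp m (u x) * h x) * \<phi> x =
        damp m (f n x) * ((f' n x - h x) * \<phi> x) + (damp m (f n x) - damp m (u x)) * (h x * \<phi> x)"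
      by (simp add: algebra_simps)
    also have "\<bar>\<dots>\<bar> \<le> \<bar>damp m (f n x)\<bar> * \<bar>(f' n x - h x) * \<phi> x\<bar> + \<bar>damp m (f n x) - damp m (u x)\<bar> * \<bar>h x * \<phi> x\<bar>"
      unfolding abs_mult[symmetric] by (rule abs_triangle_ineq)
    also have "\<dots> \<le> 1 * \<bar>(f' n x - h x) * \<phi> x\<bar> + (\<bar>m\<bar> * \<bar>f n x - u x\<bar>) * \<bar>h x * \<phi> x\<bar>"
      using damp_bounds[of m "f n x"] by (intro add_mono mult_right_mono damp_lipschitz) auto
    also have "\<dots> = \<bar>f' n x - h x\<bar> * \<bar>\<phi> x\<bar> + m * (\<bar>f n x - u x\<bar> * \<bar>h x * \<phi> x\<bar>)"
      using m by (simp add: abs_mult mult.assoc)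
    finally show "\<bar>(damp m (f n x) * f' n x) * \<phi> x - (damp m (u x) * h x) * \<phi> x\<bar>
        \<le> \<bar>f' n x - h x\<bar> * \<bar>\<phi> x\<bar> + m * (\<bar>f n x - u x\<bar> * \<bar>h x * \<phi> x\<bar>)" .
  qed (intro damp_int meas sq h)+
  then have "(\<lambda>n. LINT x|?M. (arctan (m * f n x) / m) * partial i \<phi> x) \<longlonglongrightarrow>
      - (LINT x|?M. (damp m (u x) * h x) * \<phi> x)"
    unfolding parts by (rule tendsto_minus)
  ultimately show ?thesis by (rule LIMSEQ_unique)
qed

text \<open>As \<open>m\<close> tends to infinity in \<open>truncated_integration_by_parts\<close>, the left side tends to zero and
  \<open>damp m u\<close> to the indicator of \<open>{u = 0}\<close>. So \<open>h\<close>, cut off to the zero set of \<open>u\<close>, is orthogonal to all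
  test functions.\<close>

lemma derivative_zero_on_zero_set:
  assumes i: "i < d"
    and f: "\<And>n. has_partial d i (f n) (f' n)" "\<And>n. continuous_on (Rn d) (f n)" "\<And>n. continuous_on (Rn d) (f' n)"
    and u: "sq_integrable (leb_on d \<Omega>) u" and h: "sq_integrable (leb_on d \<Omega>) h"
    and lim_u: "(\<lambda>n. LINT x|leb_on d \<Omega>. (f n x - u x)\<^sup>2) \<longlonglongrightarrow> 0"
    and lim_h: "(\<lambda>n. LINT x|leb_on d \<Omega>. (f' n x - h x)\<^sup>2) \<longlonglongrightarrow> 0"
  shows "AE x in leb_on d \<Omega>. u x = 0 \<longrightarrow> h x = 0"
proof -
  let ?M = "leb_on d \<Omega>"
  let ?h = "\<lambda>x. if u x = 0 then h x else 0"
  have meas[measurable]: "u \<in> borel_measurable ?M" "h \<in> borel_measurable ?M"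
    using u h by (auto simp: sq_integrable_def)
  have int_h: "integrable ?M h" by (rule sq_integrable_imp_integrable[OF h])
  have "integrable ?M ?h"
    by (rule Bochner_Integration.integrable_bound[OF int_h]) auto
  then have loc: "?h \<in> L1_loc d \<Omega>" by (rule integrable_in_L1_loc)
  have "AE x in leb d. x \<in> \<Omega> \<longrightarrow> ?h x = 0"
  proof (rule fundamental_lemma[OF open_\<Omega> loc])
    fix \<phi> assume \<phi>: "\<phi> \<in> test_functions d \<Omega>"
    have cont: "continuous_on (Rn d) \<phi>" "continuous_on (Rn d) (partial i \<phi>)"
      using \<phi> test_functions_partial[OF \<phi> i] smooth_continuous unfolding test_functions_iff by blast+
    have sq: "sq_integrable ?M \<phi>" "sq_integrable ?M (partial i \<phi>)"
      by (rule continuous_sq_integrable cont)+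
    have meas\<phi>[measurable]: "\<phi> \<in> borel_measurable ?M" "partial i \<phi> \<in> borel_measurable ?M"
      using sq by (auto simp: sq_integrable_def)
    have int: "integrable ?M (\<lambda>x. h x * \<phi> x)" "integrable ?M (partial i \<phi>)"
      by (rule sq_integrable_mult[OF h sq(1)]) (rule sq_integrable_imp_integrable[OF sq(2)])
    let ?m = "\<lambda>k. real (Suc k)"
    have "(\<lambda>k. LINT x|?M. (damp (?m k) (u x) * h x) * \<phi> x) \<longlonglongrightarrow> (LINT x|?M. ?h x * \<phi> x)"
    proof (rule integral_dominated_convergence[where w = "\<lambda>x. \<bar>h x * \<phi> x\<bar>"])
      show "AE x in ?M. (\<lambda>k. (damp (?m k) (u x) * h x) * \<phi> x) \<longlonglongrightarrow> ?h x * \<phi> x"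
      proof (rule AE_I2)
        fix x
        have "(\<lambda>k. (damp (?m k) (u x) * h x) * \<phi> x) \<longlonglongrightarrow> ((if u x = 0 then 1 else 0) * h x) * \<phi> x"
          by (intro tendsto_mult damp_tendsto tendsto_const)
        then show "(\<lambda>k. (damp (?m k) (u x) * h x) * \<phi> x) \<longlonglongrightarrow> ?h x * \<phi> x" by (cases "u x = 0") simp_all
      qed
      show "AE x in ?M. norm ((damp (?m k) (u x) * h x) * \<phi> x) \<le> \<bar>h x * \<phi> x\<bar>" for k
      proof (rule AE_I2)
        fix x
        have "\<bar>damp (?m k) (u x)\<bar> * \<bar>h x * \<phi> x\<bar> \<le> 1 * \<bar>h x * \<phi> x\<bar>"
          using damp_bounds[of "?m k" "u x"] by (intro mult_right_mono) auto
        then show "norm ((damp (?m k) (u x) * h x) * \<phi> x) \<le> \<bar>h x * \<phi> x\<bar>"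
          by (simp add: abs_mult mult.assoc)
      qed
      show "(\<lambda>x. (damp (?m k) (u x) * h x) * \<phi> x) \<in> borel_measurable ?M" for k
        unfolding damp_def by measurable
      show "integrable ?M (\<lambda>x. \<bar>h x * \<phi> x\<bar>)" using int(1) by simp
    qed measurable
    moreover have "(\<lambda>k. LINT x|?M. (damp (?m k) (u x) * h x) * \<phi> x) \<longlonglongrightarrow> 0"
    proof (rule Lim_null_comparison)
      have "(\<lambda>k. 2 * (LINT x|?M. \<bar>partial i \<phi> x\<bar>) * inverse (?m k)) \<longlonglongrightarrow> 2 * (LINT x|?M. \<bar>partial i \<phi> x\<bar>) * 0"
        by (intro tendsto_mult tendsto_const LIMSEQ_inverse_real_of_nat)
      then show "(\<lambda>k. 2 * (LINT x|?M. \<bar>partial i \<phi> x\<bar>) * inverse (?m k)) \<longlonglongrightarrow> 0" by simp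
      have "\<bar>LINT x|?M. (damp (?m k) (u x) * h x) * \<phi> x\<bar> \<le> 2 * (LINT x|?M. \<bar>partial i \<phi> x\<bar>) * inverse (?m k)" for k
      proof -
        have "(LINT x|?M. (damp (?m k) (u x) * h x) * \<phi> x) = - (LINT x|?M. (arctan (?m k * u x) / ?m k) * partial i \<phi> x)"
          using truncated_integration_by_parts[OF i _ \<phi> f u h lim_u lim_h, of "?m k"] by simp
        also have "\<bar>\<dots>\<bar> \<le> (LINT x|?M. \<bar>(arctan (?m k * u x) / ?m k) * partial i \<phi> x\<bar>)"
          unfolding abs_minus_cancel by (rule integral_abs_bound)
        also have "\<dots> \<le> (LINT x|?M. (2 * inverse (?m k)) * \<bar>partial i \<phi> x\<bar>)"
        proof (rule integral_mono')
          fix x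
          have "\<bar>arctan (?m k * u x)\<bar> \<le> 2"
            using arctan_lbound[of "?m k * u x"] arctan_ubound[of "?m k * u x"] pi_less_4 by (simp only: abs_le_iff) linarith
          then have "\<bar>arctan (?m k * u x) / ?m k\<bar> \<le> 2 * inverse (?m k)"
            by (simp add: divide_inverse abs_mult del: of_nat_Suc)
          then show "\<bar>(arctan (?m k * u x) / ?m k) * partial i \<phi> x\<bar> \<le> (2 * inverse (?m k)) * \<bar>partial i \<phi> x\<bar>"
            unfolding abs_mult[of "arctan (?m k * u x) / ?m k"] by (rule mult_right_mono) simp
        qed (use int(2) in auto)
        also have "\<dots> = 2 * (LINT x|?M. \<bar>partial i \<phi> x\<bar>) * inverse (?m k)"
          by simp
        finally show ?thesis .
      qed
      then show "\<forall>\<^sub>F k in sequentially. norm (LINT x|?M. (damp (?m k) (u x) * h x) * \<phi> x)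
          \<le> 2 * (LINT x|?M. \<bar>partial i \<phi> x\<bar>) * inverse (?m k)"
        unfolding real_norm_def by (intro always_eventually allI)
    qed
    ultimately have "(LINT x|?M. ?h x * \<phi> x) = 0" by (rule LIMSEQ_unique)
    then show "(LINT x|leb d. ?h x * \<phi> x) = 0"
      by (simp only: integral_test_leb_on[OF \<phi>])
  qed
  then show ?thesis
    unfolding AE_leb_on_iff by eventually_elim (auto split: if_splits)
qed

end

section \<open>The paraboloid and approximation in the Sobolev space\<close>

lemma smooth_RnI:
  assumes "continuous_on (Rn d) f"
    and "\<And>i x. i < d \<Longrightarrow> ((\<lambda>t. f (x(i := t))) has_real_derivative g i x) (at (x i))"
    and "\<And>i. i < d \<Longrightarrow> smooth_Rn d (g i)"
  shows "smooth_Rn d f" "\<And>i. i < d \<Longrightarrow> partial i f = g i"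
proof -
  have p: "partial i f = g i" if "i < d" for i
  proof
    fix x show "partial i f x = g i x"
      using DERIV_imp_deriv[OF assms(2)[OF that]] by (simp add: partial_def)
  qed
  then show "\<And>i. i < d \<Longrightarrow> partial i f = g i" .
  have c: "continuous_map (subtopology (Euclidean_space d) (Rn d)) euclideanreal f"
    using Ck_on_0[OF order_refl, of d f] assms(1) by simp
  have diff: "(\<lambda>t. f (x(i := t))) differentiable (at (x i))" if "i < d" for i x
    using assms(2)[OF that] real_differentiable_def by blast
  have "Ck_on d k (Rn d) f" for k
  proof (cases k)
    case (Suc m)
    show ?thesis
      using c diff p assms(3) unfolding Suc Ck_on.simps smooth_Rn_def by simp
  qed (use c in simp)
  then show "smooth_Rn d f" by (simp add: smooth_Rn_def)
qed

lemma smooth_const: "smooth_Rn d (\<lambda>_. c)"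
proof -
  have "Ck_on d k (Rn d) (\<lambda>_. c)" for k
  proof (induction k arbitrary: c)
    case (Suc k)
    have "partial i (\<lambda>_. c) = (\<lambda>_. 0)" for i
      by (simp add: partial_def fun_eq_iff)
    then show ?case using Suc[of 0] by simp
  qed simp
  then show ?thesis by (simp add: smooth_Rn_def)
qed

lemma smooth_coordinate: "smooth_Rn d (\<lambda>x. c * x j)"
  and partial_coordinate: "i < d \<Longrightarrow> partial i (\<lambda>x. c * x j) = (\<lambda>_. if i = j then c else 0)"
proof -
  have 1: "continuous_on (Rn d) (\<lambda>x. c * x j)"
    by (intro continuous_on_mult continuous_on_const continuous_on_subset[OF continuous_on_product_coordinates]) simp
  have 2: "((\<lambda>t. c * (x(i := t)) j) has_real_derivative (if i = j then c else 0)) (at (x i))" for i x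
    by (cases "i = j") (auto intro!: derivative_eq_intros)
  show "smooth_Rn d (\<lambda>x. c * x j)"
    by (rule smooth_RnI(1)[OF 1 2]) (rule smooth_const)
  show "i < d \<Longrightarrow> partial i (\<lambda>x. c * x j) = (\<lambda>_. if i = j then c else 0)"
    by (rule smooth_RnI(2)[OF 1 2]) (rule smooth_const)
qed

text \<open>Normalised to have Laplacian \<open>1\<close>.\<close>

definition paraboloid :: "nat \<Rightarrow> (nat \<Rightarrow> real) \<Rightarrow> real" where
  "paraboloid d x = (\<Sum>i<d. (x i)\<^sup>2) / (2 * real d)"

lemma smooth_paraboloid: "smooth_Rn d (paraboloid d)"
  and partial_paraboloid: "i < d \<Longrightarrow> partial i (paraboloid d) = (\<lambda>x. (1 / real d) * x i)"
proof -
  have 1: "continuous_on (Rn d) (paraboloid d)"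
    unfolding paraboloid_def divide_inverse
    by (intro continuous_on_mult continuous_on_sum continuous_on_power continuous_on_const
        continuous_on_subset[OF continuous_on_product_coordinates]) auto
  have 2: "((\<lambda>t. paraboloid d (x(i := t))) has_real_derivative (1 / real d) * x i) (at (x i))" if "i < d" for i x
  proof -
    have "((\<lambda>t. \<Sum>j<d. ((x(i := t)) j)\<^sup>2) has_real_derivative (\<Sum>j<d. if j = i then 2 * x i else 0)) (at (x i))"
    proof (rule DERIV_sum)
      fix j show "((\<lambda>t. ((x(i := t)) j)\<^sup>2) has_real_derivative (if j = i then 2 * x i else 0)) (at (x i))"
        by (cases "j = i") (auto intro!: derivative_eq_intros)
    qed
    from DERIV_cdivide[OF this, of "2 * real d"] show ?thesis
      unfolding paraboloid_def using that by simp
  qed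
  show "smooth_Rn d (paraboloid d)"
    by (rule smooth_RnI(1)[OF 1 2 smooth_coordinate])
  show "i < d \<Longrightarrow> partial i (paraboloid d) = (\<lambda>x. (1 / real d) * x i)"
    by (rule smooth_RnI(2)[OF 1 2 smooth_coordinate])
qed

lemma partial_partial_paraboloid: "i < d \<Longrightarrow> partial i (partial i (paraboloid d)) = (\<lambda>_. 1 / real d)"
  using partial_coordinate[of i d "1 / real d" i] by (simp add: partial_paraboloid)

lemma has_partial_add:
  "has_partial d i f f' \<Longrightarrow> has_partial d i g g' \<Longrightarrow> has_partial d i (\<lambda>x. f x + g x) (\<lambda>x. f' x + g' x)"
  unfolding has_partial_def by (auto intro: DERIV_add)

lemma finite_multi_indices: "finite (multi_indices d k)"
  unfolding multi_indices_def by (rule finite_lists_length_le) simp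

context bounded_domain
begin

text \<open>Completeness matters because the chosen weak derivatives are only known up to null sets: it makes
  them measurable on \<open>\<Omega>\<close> as soon as one version is.\<close>

lemma complete_leb_on: "complete_measure (leb_on d \<Omega>)"
proof
  fix A B assume "B \<subseteq> A" "A \<in> null_sets (leb_on d \<Omega>)"
  then have "A \<in> null_sets (completion (leb_borel d))" "B \<subseteq> \<Omega>"
    using null_sets_restrict_space[of \<Omega> "leb d" A] openin_in_sets_leb[OF open_\<Omega>]
    unfolding leb_on_def leb_eq by auto
  then have "B \<in> sets (leb d)"
    unfolding leb_eq using completion.complete \<open>B \<subseteq> A\<close> by blast
  then show "B \<in> sets (leb_on d \<Omega>)"
    unfolding leb_on_def using \<open>B \<subseteq> \<Omega>\<close> sets_restrict_space_iff[OF \<Omega>_sets] by blast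
qed

lemma borel_measurable_AE:
  fixes f g :: "(nat \<Rightarrow> real) \<Rightarrow> real"
  assumes ae: "AE x in leb_on d \<Omega>. f x = g x" and g: "g \<in> borel_measurable (leb_on d \<Omega>)"
  shows "f \<in> borel_measurable (leb_on d \<Omega>)"
proof (rule measurableI)
  fix A :: "real set" assume A: "A \<in> sets borel"
  show "f -` A \<inter> space (leb_on d \<Omega>) \<in> sets (leb_on d \<Omega>)"
  proof (rule complete_measure.in_sets_AE[OF complete_leb_on])
    show "g -` A \<inter> space (leb_on d \<Omega>) \<in> sets (leb_on d \<Omega>)"
      by (rule measurable_sets[OF g A])
    show "AE x in leb_on d \<Omega>. (x \<in> g -` A \<inter> space (leb_on d \<Omega>)) = (x \<in> f -` A \<inter> space (leb_on d \<Omega>))"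
      using ae by eventually_elim simp
  qed simp
qed simp

lemma integral_cong_AE_leb_on:
  fixes f g :: "(nat \<Rightarrow> real) \<Rightarrow> real"
  assumes "AE x in leb_on d \<Omega>. f x = g x" "g \<in> borel_measurable (leb_on d \<Omega>)"
  shows "integral\<^sup>L (leb_on d \<Omega>) f = integral\<^sup>L (leb_on d \<Omega>) g"
  by (rule integral_cong_AE[OF borel_measurable_AE[OF assms] assms(2,1)])

lemma smooth_in_H2:
  assumes "smooth_Rn d f" shows "f \<in> H2 d \<Omega>"
  unfolding H2_def L2_iff
proof (intro CollectI conjI ballI bexI)
  show "sq_integrable (leb_on d \<Omega>) f"
    by (intro continuous_sq_integrable smooth_continuous assms)
  fix \<alpha> assume "\<alpha> \<in> multi_indices d 2"
  then have \<alpha>: "set \<alpha> \<subseteq> {..<d}" by (simp add: multi_indices_def)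
  show "has_weak_deriv d \<Omega> \<alpha> f (partials (rev \<alpha>) f)"
    by (rule smooth_has_weak_deriv[OF assms \<alpha>])
  show "partials (rev \<alpha>) f \<in> L2 d \<Omega>"
    unfolding L2_iff by (intro continuous_sq_integrable smooth_continuous smooth_partials assms) (use \<alpha> in simp)
qed

text \<open>Uniqueness of weak derivatives turns convergence in the norm, which is stated with chosen
  representatives, into \<open>L\<^sup>2\<close> convergence of the classical derivatives of the test functions.\<close>

lemma H2_0_approximation:
  assumes w: "w \<in> H2_0 d \<Omega>"
  shows "\<exists>\<phi> G. (\<forall>n. \<phi> n \<in> test_functions d \<Omega>) \<and>
    (\<forall>\<alpha>\<in>multi_indices d 2. sq_integrable (leb_on d \<Omega>) (G \<alpha>) \<and> has_weak_deriv d \<Omega> \<alpha> w (G \<alpha>) \<and>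
      (\<lambda>n. LINT x|leb_on d \<Omega>. (partials (rev \<alpha>) (\<phi> n) x - G \<alpha> x)\<^sup>2) \<longlonglongrightarrow> 0)"
proof -
  have "w \<in> H2 d \<Omega>" using w by (simp add: H2_0_def)
  then have "\<forall>\<alpha>\<in>multi_indices d 2. \<exists>g. sq_integrable (leb_on d \<Omega>) g \<and> has_weak_deriv d \<Omega> \<alpha> w g"
    unfolding H2_def Bex_def L2_iff by blast
  then obtain G where G: "\<And>\<alpha>. \<alpha> \<in> multi_indices d 2 \<Longrightarrow> sq_integrable (leb_on d \<Omega>) (G \<alpha>) \<and> has_weak_deriv d \<Omega> \<alpha> w (G \<alpha>)"
    by metis
  obtain \<phi> where \<phi>: "\<And>n. \<phi> n \<in> test_functions d \<Omega>" "(\<lambda>n. H2_norm d \<Omega> (\<lambda>x. w x - \<phi> n x)) \<longlonglongrightarrow> 0"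
    using w by (auto simp: H2_0_def)
  define S where "S n \<alpha> = (LINT x|leb_on d \<Omega>. (partials (rev \<alpha>) (\<phi> n) x - G \<alpha> x)\<^sup>2)" for n \<alpha>
  have S_nonneg: "0 \<le> S n \<alpha>" for n \<alpha>
    unfolding S_def by (rule integral_nonneg_AE) simp
  have S_eq: "(LINT x:\<Omega>|leb d. (weak_deriv d \<Omega> \<alpha> (\<lambda>x. w x - \<phi> n x) x)\<^sup>2) = S n \<alpha>"
    if \<alpha>: "\<alpha> \<in> multi_indices d 2" for n \<alpha>
  proof -
    have set: "set \<alpha> \<subseteq> {..<d}" using \<alpha> by (simp add: multi_indices_def)
    have sm: "smooth_Rn d (\<phi> n)" using \<phi>(1)[of n] unfolding test_functions_iff by blast
    have "has_weak_deriv d \<Omega> \<alpha> (\<lambda>x. w x + (- 1) * \<phi> n x) (\<lambda>x. G \<alpha> x + (- 1) * partials (rev \<alpha>) (\<phi> n) x)"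
      using has_weak_deriv_lincomb[OF _ smooth_has_weak_deriv[OF sm set] set] G[OF \<alpha>] by blast
    from weak_deriv_AE[OF this]
    have ae: "AE x in leb_on d \<Omega>. weak_deriv d \<Omega> \<alpha> (\<lambda>x. w x - \<phi> n x) x = G \<alpha> x - partials (rev \<alpha>) (\<phi> n) x"
      by simp
    have "sq_integrable (leb_on d \<Omega>) (\<lambda>x. partials (rev \<alpha>) (\<phi> n) x - G \<alpha> x)"
      using G[OF \<alpha>] set
      by (intro sq_integrable_diff[OF continuous_sq_integrable[OF smooth_continuous[OF smooth_partials[OF sm]]]]) auto
    then have "(\<lambda>x. (partials (rev \<alpha>) (\<phi> n) x - G \<alpha> x)\<^sup>2) \<in> borel_measurable (leb_on d \<Omega>)"
      unfolding sq_integrable_def by (blast intro: borel_measurable_integrable)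
    moreover have "AE x in leb_on d \<Omega>. (weak_deriv d \<Omega> \<alpha> (\<lambda>x. w x - \<phi> n x) x)\<^sup>2 = (partials (rev \<alpha>) (\<phi> n) x - G \<alpha> x)\<^sup>2"
      using ae by eventually_elim (simp add: power2_commute)
    ultimately show ?thesis
      unfolding set_integral_leb_on S_def by (intro integral_cong_AE_leb_on)
  qed
  have "(\<lambda>n. sqrt (\<Sum>\<alpha>\<in>multi_indices d 2. S n \<alpha>)) \<longlonglongrightarrow> 0"
    using \<phi>(2) unfolding H2_norm_def by (simp add: S_eq cong: sum.cong)
  from tendsto_power[OF this, of 2]
  have sum0: "(\<lambda>n. \<Sum>\<alpha>\<in>multi_indices d 2. S n \<alpha>) \<longlonglongrightarrow> 0"
    by (simp add: sum_nonneg S_nonneg)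
  have "(\<lambda>n. S n \<alpha>) \<longlonglongrightarrow> 0" if "\<alpha> \<in> multi_indices d 2" for \<alpha>
  proof (rule Lim_null_comparison[OF _ sum0], intro always_eventually allI)
    fix n show "norm (S n \<alpha>) \<le> (\<Sum>\<alpha>\<in>multi_indices d 2. S n \<alpha>)"
      using member_le_sum[OF that _ finite_multi_indices, of "S n"] S_nonneg by simp
  qed
  then show ?thesis
    using G \<phi>(1) unfolding S_def by blast
qed

end

section \<open>Minimality of the paraboloid\<close>

context bounded_domain
begin

text \<open>The Laplacian of a competitor has the mean value of that of the paraboloid, as pure second
  derivatives of test functions integrate to zero. It vanishes on \<open>{v = 0}\<close> because the first
  derivatives do, and then the second derivatives vanish on the zero sets of the first ones.\<close>

lemma competitor_laplacian:
  assumes d: "1 \<le> d" and w: "(\<lambda>x. v x - paraboloid d x) \<in> H2_0 d \<Omega>"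
  shows "\<exists>h. sq_integrable (leb_on d \<Omega>) h \<and>
    (AE x in leb_on d \<Omega>. weak_laplacian d \<Omega> v x = h x) \<and>
    (AE x in leb_on d \<Omega>. v x = 0 \<longrightarrow> h x = 0) \<and>
    (LINT x|leb_on d \<Omega>. h x) = measure (leb d) \<Omega>"
proof -
  let ?M = "leb_on d \<Omega>" and ?u = "paraboloid d"
  define w where "w = (\<lambda>x. v x - ?u x)"
  obtain \<phi> G where "(\<forall>n. \<phi> n \<in> test_functions d \<Omega>) \<and>
    (\<forall>\<alpha>\<in>multi_indices d 2. sq_integrable ?M (G \<alpha>) \<and> has_weak_deriv d \<Omega> \<alpha> w (G \<alpha>) \<and>
      (\<lambda>n. LINT x|?M. (partials (rev \<alpha>) (\<phi> n) x - G \<alpha> x)\<^sup>2) \<longlonglongrightarrow> 0)"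
    using H2_0_approximation[OF assms(2)[folded w_def]] by (elim exE) (rule that)
  then have \<phi>: "\<And>n. \<phi> n \<in> test_functions d \<Omega>"
    and G: "\<And>\<alpha>. \<alpha> \<in> multi_indices d 2 \<Longrightarrow> sq_integrable ?M (G \<alpha>) \<and> has_weak_deriv d \<Omega> \<alpha> w (G \<alpha>) \<and>
      (\<lambda>n. LINT x|?M. (partials (rev \<alpha>) (\<phi> n) x - G \<alpha> x)\<^sup>2) \<longlonglongrightarrow> 0"
    by auto
  have mi: "[] \<in> multi_indices d 2" "\<And>i. i < d \<Longrightarrow> [i] \<in> multi_indices d 2" "\<And>i. i < d \<Longrightarrow> [i, i] \<in> multi_indices d 2"
    by (auto simp: multi_indices_def)
  have smooth: "smooth_Rn d (\<phi> n)" for n using \<phi>[of n] unfolding test_functions_iff by blast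
  have G0: "AE x in ?M. G [] x = w x"
  proof -
    have hw: "has_weak_deriv d \<Omega> [] w (G [])" using G[OF mi(1)] by blast
    then have "has_weak_deriv d \<Omega> [] w w"
      unfolding has_weak_deriv_def by (simp add: partials_def)
    from has_weak_deriv_unique[OF open_\<Omega> hw this] show ?thesis
      unfolding AE_leb_on_iff .
  qed
  have sq0: "sq_integrable ?M (G [])" and lim0: "(\<lambda>n. LINT x|?M. (\<phi> n x - G [] x)\<^sup>2) \<longlonglongrightarrow> 0"
    using G[OF mi(1)] by (auto simp: partials_def)
  have sq1: "sq_integrable ?M (G [i])" and lim1: "(\<lambda>n. LINT x|?M. (partial i (\<phi> n) x - G [i] x)\<^sup>2) \<longlonglongrightarrow> 0"
    if "i < d" for i
    using G[OF mi(2)[OF that]] by (auto simp: partials_def)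
  have sq2: "sq_integrable ?M (G [i, i])" and wd2: "has_weak_deriv d \<Omega> [i, i] w (G [i, i])"
    and lim2: "(\<lambda>n. LINT x|?M. (partial i (partial i (\<phi> n)) x - G [i, i] x)\<^sup>2) \<longlonglongrightarrow> 0"
    if "i < d" for i
    using G[OF mi(3)[OF that]] by (auto simp: partials_def)
  have u_smooth: "smooth_Rn d ?u" by (rule smooth_paraboloid)
  have zero1: "AE x in ?M. ?u x + G [] x = 0 \<longrightarrow> partial i ?u x + G [i] x = 0" if i: "i < d" for i
  proof (rule derivative_zero_on_zero_set[OF i, where f = "\<lambda>n x. ?u x + \<phi> n x" and f' = "\<lambda>n x. partial i ?u x + partial i (\<phi> n) x"])
    show "sq_integrable ?M (\<lambda>x. ?u x + G [] x)" "sq_integrable ?M (\<lambda>x. partial i ?u x + G [i] x)"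
      by (intro sq_integrable_add continuous_sq_integrable smooth_continuous smooth_partial u_smooth sq0 sq1 i)+
    show "(\<lambda>n. LINT x|?M. (?u x + \<phi> n x - (?u x + G [] x))\<^sup>2) \<longlonglongrightarrow> 0" using lim0 by simp
    show "(\<lambda>n. LINT x|?M. (partial i ?u x + partial i (\<phi> n) x - (partial i ?u x + G [i] x))\<^sup>2) \<longlonglongrightarrow> 0"
      using lim1[OF i] by simp
  qed (intro has_partial_add smooth_has_partial continuous_on_add smooth_continuous smooth_partial u_smooth smooth i)+
  have zero2: "AE x in ?M. partial i ?u x + G [i] x = 0 \<longrightarrow> partial i (partial i ?u) x + G [i, i] x = 0" if i: "i < d" for i
  proof (rule derivative_zero_on_zero_set[OF i, where f = "\<lambda>n x. partial i ?u x + partial i (\<phi> n) x"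
        and f' = "\<lambda>n x. partial i (partial i ?u) x + partial i (partial i (\<phi> n)) x"])
    show "sq_integrable ?M (\<lambda>x. partial i ?u x + G [i] x)" "sq_integrable ?M (\<lambda>x. partial i (partial i ?u) x + G [i, i] x)"
      by (intro sq_integrable_add continuous_sq_integrable smooth_continuous smooth_partial u_smooth sq1 sq2 i)+
    show "(\<lambda>n. LINT x|?M. (partial i ?u x + partial i (\<phi> n) x - (partial i ?u x + G [i] x))\<^sup>2) \<longlonglongrightarrow> 0"
      using lim1[OF i] by simp
    show "(\<lambda>n. LINT x|?M. (partial i (partial i ?u) x + partial i (partial i (\<phi> n)) x - (partial i (partial i ?u) x + G [i, i] x))\<^sup>2) \<longlonglongrightarrow> 0"
      using lim2[OF i] by simp
  qed (intro has_partial_add smooth_has_partial continuous_on_add smooth_continuous smooth_partial u_smooth smooth i)+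
  define h where "h = (\<lambda>x. \<Sum>i<d. 1 / real d + G [i, i] x)"
  have sq_h: "sq_integrable ?M h"
  proof -
    have "sq_integrable ?M (\<lambda>x. \<Sum>i\<in>I. 1 / real d + G [i, i] x)" if "finite I" "I \<subseteq> {..<d}" for I
      using that
    proof (induction I rule: finite_induct)
      case empty
      show ?case by (simp add: sq_integrable_def)
    next
      case (insert i I)
      have "sq_integrable ?M (\<lambda>_. 1 / real d)" by (rule continuous_sq_integrable) simp
      then show ?case using insert by (simp add: sq_integrable_add sq2)
    qed
    then show ?thesis unfolding h_def by blast
  qed
  have weak: "AE x in ?M. weak_deriv d \<Omega> [i, i] v x = 1 / real d + G [i, i] x" if i: "i < d" for i
  proof -
    have "has_weak_deriv d \<Omega> [i, i] ?u (partials (rev [i, i]) ?u)"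
      by (rule smooth_has_weak_deriv[OF u_smooth]) (use i in simp)
    from has_weak_deriv_lincomb[OF this wd2[OF i], of 1]
    have "has_weak_deriv d \<Omega> [i, i] v (\<lambda>x. 1 / real d + G [i, i] x)"
      using i by (simp add: partials_def partial_partial_paraboloid w_def)
    then show ?thesis by (rule weak_deriv_AE)
  qed
  have "AE x in ?M. \<forall>i\<in>{..<d}. weak_deriv d \<Omega> [i, i] v x = 1 / real d + G [i, i] x"
    by (rule AE_finite_allI) (use weak in auto)
  then have lap: "AE x in ?M. weak_laplacian d \<Omega> v x = h x"
    by eventually_elim (simp add: weak_laplacian_def h_def)
  have "AE x in ?M. \<forall>i\<in>{..<d}. ?u x + G [] x = 0 \<longrightarrow> partial i (partial i ?u) x + G [i, i] x = 0"
  proof (rule AE_finite_allI)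
    fix i assume "i \<in> {..<d}"
    then have i: "i < d" by simp
    show "AE x in ?M. ?u x + G [] x = 0 \<longrightarrow> partial i (partial i ?u) x + G [i, i] x = 0"
      using zero1[OF i] zero2[OF i] by eventually_elim blast
  qed simp
  with G0 have zero: "AE x in ?M. v x = 0 \<longrightarrow> h x = 0"
  proof eventually_elim
    case (elim x)
    then show ?case by (auto simp: w_def h_def partial_partial_paraboloid intro!: sum.neutral)
  qed
  have int0: "(LINT x|?M. G [i, i] x) = 0" if i: "i < d" for i
  proof -
    let ?\<psi> = "\<lambda>n. partial i (partial i (\<phi> n))"
    have sq\<psi>: "sq_integrable ?M (?\<psi> n)" for n
      by (intro continuous_sq_integrable smooth_continuous smooth_partial smooth i)
    have one: "sq_integrable ?M (\<lambda>_. 1)" by (rule continuous_sq_integrable) simp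
    have "(\<lambda>n. LINT x|?M. ?\<psi> n x) \<longlonglongrightarrow> (LINT x|?M. G [i, i] x)"
    proof (rule integral_tendsto_dominated_error)
      show "(\<lambda>n. LINT x|?M. \<bar>?\<psi> n x - G [i, i] x\<bar> * \<bar>1\<bar>) \<longlonglongrightarrow> 0"
        by (rule L2_limit_pairing[OF sq_integrable_diff[OF sq\<psi> sq2[OF i]] one lim2[OF i]])
      show "integrable ?M (\<lambda>x. \<bar>?\<psi> n x - G [i, i] x\<bar> * \<bar>1\<bar>)" for n
        by (rule sq_integrable_mult[OF sq_integrable_abs[OF sq_integrable_diff[OF sq\<psi> sq2[OF i]]] sq_integrable_abs[OF one]])
    qed (auto intro: sq_integrable_imp_integrable sq\<psi> sq2 i)
    moreover have "(LINT x|?M. ?\<psi> n x) = 0" for n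
    proof -
      have test: "partial i (\<phi> n) \<in> test_functions d \<Omega>" by (rule test_functions_partial[OF \<phi> i])
      then obtain K where K: "compact_support d \<Omega> K (partial i (\<phi> n))" "smooth_Rn d (partial i (\<phi> n))"
        unfolding test_functions_iff by blast
      have "(LINT x|leb d. ?\<psi> n x) = 0"
        by (rule integral_partial_eq_0[OF smooth_has_partial[OF K(2) i] smooth_continuous[OF smooth_partial[OF K(2) i]] K(1) i])
      moreover have "(LINT x|leb d. 1 * ?\<psi> n x) = (LINT x|?M. 1 * ?\<psi> n x)"
        by (rule integral_test_leb_on[OF test_functions_partial[OF test i]])
      ultimately show ?thesis by simp
    qed
    ultimately show ?thesis by (simp add: LIMSEQ_const_iff)
  qed
  have int: "integrable ?M (G [i, i])" if "i < d" for i
    by (rule sq_integrable_imp_integrable[OF sq2[OF that]])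
  have "(LINT x|?M. h x) = (\<Sum>i<d. LINT x|?M. 1 / real d + G [i, i] x)"
    unfolding h_def by (rule Bochner_Integration.integral_sum) (auto intro: int)
  also have "\<dots> = (\<Sum>i<d. measure ?M \<Omega> / real d)"
  proof (rule sum.cong[OF refl])
    fix i assume "i \<in> {..<d}"
    then show "(LINT x|?M. 1 / real d + G [i, i] x) = measure ?M \<Omega> / real d"
      using int int0 by (simp add: space_leb_on)
  qed
  also have "\<dots> = measure (leb d) \<Omega>"
    using d measure_leb_on[of \<Omega>] by simp
  finally show ?thesis using sq_h lap zero by blast
qed

text \<open>This is \<open>|{v = 0}| \<le> \<integral> (h - 1)\<^sup>2\<close> for the Laplacian \<open>h\<close> of \<open>v\<close>, with the square expanded.\<close>

lemma AC_functional_competitor: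
  assumes d: "1 \<le> d" and v: "v \<in> H2 d \<Omega>" and w: "(\<lambda>x. v x - paraboloid d x) \<in> H2_0 d \<Omega>"
  shows "2 * measure (leb d) \<Omega> \<le> AC_functional d v \<Omega>"
proof -
  let ?M = "leb_on d \<Omega>"
  obtain h where h: "sq_integrable ?M h" "AE x in ?M. weak_laplacian d \<Omega> v x = h x"
    "AE x in ?M. v x = 0 \<longrightarrow> h x = 0" "(LINT x|?M. h x) = measure (leb d) \<Omega>"
    using competitor_laplacian[OF d w] by blast
  have int: "integrable ?M (\<lambda>x. (h x)\<^sup>2)" "integrable ?M h"
    using h(1) sq_integrable_imp_integrable[OF h(1)] by (simp_all add: sq_integrable_def)
  have meas_v: "v \<in> borel_measurable ?M"
    using v unfolding H2_def L2_iff sq_integrable_def by blast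
  define Z where "Z = {x \<in> \<Omega>. v x = 0}"
  have Z: "Z \<in> sets ?M"
    using measurable_sets[OF meas_v, of "{0}"] by (simp add: Z_def space_leb_on vimage_def Int_def conj_commute)
  have "AE x in ?M. indicator Z x \<le> (h x - 1)\<^sup>2"
    using h(3) by eventually_elim (auto simp: Z_def indicator_def)
  moreover have "integrable ?M (indicator Z :: _ \<Rightarrow> real)"
    using Z by (simp add: emeasure_eq_measure)
  moreover have sq: "integrable ?M (\<lambda>x. (h x - 1)\<^sup>2)" "(LINT x|?M. (h x - 1)\<^sup>2) = (LINT x|?M. (h x)\<^sup>2) - measure ?M \<Omega>"
  proof -
    have eq: "(\<lambda>x. (h x - 1)\<^sup>2) = (\<lambda>x. (h x)\<^sup>2 - 2 * h x + 1)"
      by (simp add: power2_eq_square algebra_simps fun_eq_iff)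
    show "integrable ?M (\<lambda>x. (h x - 1)\<^sup>2)" unfolding eq using int by simp
    show "(LINT x|?M. (h x - 1)\<^sup>2) = (LINT x|?M. (h x)\<^sup>2) - measure ?M \<Omega>"
      unfolding eq using int h(4) by (simp add: space_leb_on measure_leb_on)
  qed
  ultimately have "(LINT x|?M. indicator Z x) \<le> (LINT x|?M. (h x - 1)\<^sup>2)"
    by (intro integral_mono_AE)
  then have "measure ?M Z \<le> (LINT x|?M. (h x)\<^sup>2) - measure ?M \<Omega>"
    using Z sets.sets_into_space[OF Z] by (simp add: sq Int_absorb2)
  moreover have "measure ?M {x \<in> \<Omega>. v x \<noteq> 0} = measure ?M \<Omega> - measure ?M Z"
  proof -
    have "{x \<in> \<Omega>. v x \<noteq> 0} = space ?M - Z" by (auto simp: Z_def space_leb_on)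
    then show ?thesis using finite_measure_compl[OF Z] by (simp add: space_leb_on)
  qed
  moreover have "(LINT x:\<Omega>|leb d. (weak_laplacian d \<Omega> v x)\<^sup>2) = (LINT x|?M. (h x)\<^sup>2)"
    unfolding set_integral_leb_on
  proof (rule integral_cong_AE_leb_on)
    show "AE x in ?M. (weak_laplacian d \<Omega> v x)\<^sup>2 = (h x)\<^sup>2"
      using h(2) by eventually_elim simp
  qed (use int in auto)
  ultimately show ?thesis
    unfolding AC_functional_def using measure_leb_on[of \<Omega>] measure_leb_on[of "{x \<in> \<Omega>. v x \<noteq> 0}"] by simp
qed

lemma AC_functional_paraboloid:
  assumes d: "1 \<le> d"
  shows "AC_functional d (paraboloid d) \<Omega> \<le> 2 * measure (leb d) \<Omega>"
proof -
  let ?M = "leb_on d \<Omega>" and ?u = "paraboloid d"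
  have "AE x in ?M. \<forall>i\<in>{..<d}. weak_deriv d \<Omega> [i, i] ?u x = 1 / real d"
  proof (rule AE_finite_allI)
    fix i assume "i \<in> {..<d}"
    then show "AE x in ?M. weak_deriv d \<Omega> [i, i] ?u x = 1 / real d"
      using weak_deriv_AE[OF smooth_has_weak_deriv[OF smooth_paraboloid, of "[i, i]"]]
      by (simp add: partials_def partial_partial_paraboloid)
  qed simp
  then have "AE x in ?M. (weak_laplacian d \<Omega> ?u x)\<^sup>2 = 1"
    by eventually_elim (use d in \<open>simp add: weak_laplacian_def\<close>)
  then have "(LINT x:\<Omega>|leb d. (weak_laplacian d \<Omega> ?u x)\<^sup>2) = (LINT x|?M. 1)"
    unfolding set_integral_leb_on by (rule integral_cong_AE_leb_on) simp
  also have "\<dots> = measure (leb d) \<Omega>"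
    by (simp add: space_leb_on measure_leb_on)
  finally have "(LINT x:\<Omega>|leb d. (weak_laplacian d \<Omega> ?u x)\<^sup>2) = measure (leb d) \<Omega>" .
  moreover have "measure (leb d) {x \<in> \<Omega>. ?u x \<noteq> 0} \<le> measure (leb d) \<Omega>"
    using bounded_measure[of "{x \<in> \<Omega>. ?u x \<noteq> 0}"] measure_leb_on[of \<Omega>] measure_leb_on[of "{x \<in> \<Omega>. ?u x \<noteq> 0}"]
    by (simp add: space_leb_on)
  ultimately show ?thesis by (simp add: AC_functional_def)
qed

end

lemma paraboloid_global_minimizer:
  assumes "1 \<le> d" shows "global_minimizer d (paraboloid d)"
  unfolding global_minimizer_def H2_loc_def
proof (intro conjI CollectI allI impI)
  fix \<Omega> assume "openin (Euclidean_space d) \<Omega> \<and> bounded_in_Rn d \<Omega>"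
  then interpret bounded_domain d \<Omega> by (simp add: bounded_domain_def)
  show "paraboloid d \<in> H2 d \<Omega>" by (rule smooth_in_H2[OF smooth_paraboloid])
next
  fix \<Omega> v
  assume asm: "openin (Euclidean_space d) \<Omega> \<and> bounded_in_Rn d \<Omega> \<and> v \<in> H2 d \<Omega> \<and>
    (\<lambda>x. v x - paraboloid d x) \<in> H2_0 d \<Omega>"
  then interpret bounded_domain d \<Omega> by (simp add: bounded_domain_def)
  show "AC_functional d (paraboloid d) \<Omega> \<le> AC_functional d v \<Omega>"
    using AC_functional_paraboloid[OF assms] AC_functional_competitor[OF assms] asm by force
qed

section \<open>Free boundaries\<close>

lemma open_contains_line_segment:
  assumes "openin (Euclidean_space d) U" "p \<in> U" "i < d"
  shows "\<exists>\<epsilon>>0. \<forall>t. \<bar>t\<bar> < \<epsilon> \<longrightarrow> p(i := p i + t) \<in> U"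
proof -
  obtain T where T: "open T" "U = Rn d \<inter> T"
    using assms(1) unfolding openin_Euclidean by blast
  have "open ((\<lambda>t. p(i := t)) -` T)"
    by (rule open_vimage[OF T(1) continuous_fun_upd])
  moreover have "p i \<in> (\<lambda>t. p(i := t)) -` T" using assms(2) T(2) by simp
  ultimately obtain \<epsilon> where \<epsilon>: "\<epsilon> > 0" "\<forall>s. dist s (p i) < \<epsilon> \<longrightarrow> s \<in> (\<lambda>t. p(i := t)) -` T"
    unfolding open_dist by blast
  have "p(i := p i + t) \<in> U" if "\<bar>t\<bar> < \<epsilon>" for t
    using \<epsilon>(2)[rule_format, of "p i + t"] that fun_upd_Rn[of p d i "p i + t"] assms(2,3) T(2)
    by (simp add: dist_real_def)
  then show ?thesis using \<epsilon>(1) by blast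
qed

text \<open>An open subset of \<open>\<real>\<^sup>k\<close> contains a segment in a coordinate direction through each of its points.\<close>

lemma singleton_not_submanifold:
  assumes "1 \<le> k" "k \<le> d" shows "\<not> C1_submanifold d k {p}"
proof
  assume "C1_submanifold d k {p}"
  then obtain U V \<Phi> where \<Phi>: "p \<in> U" "C1_diffeo d U V \<Phi>" "\<Phi> ` ({p} \<inter> U) = V \<inter> Rn k"
    unfolding C1_submanifold_def by blast
  then have V: "openin (Euclidean_space d) V" "V \<inter> Rn k = {\<Phi> p}"
    by (auto simp: C1_diffeo_def)
  define q where "q = \<Phi> p"
  have q: "q \<in> V" "q \<in> Rn k" using V(2) by (auto simp: q_def)
  obtain \<epsilon> where \<epsilon>: "\<epsilon> > 0" "\<forall>t. \<bar>t\<bar> < \<epsilon> \<longrightarrow> q(0 := q 0 + t) \<in> V"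
    using open_contains_line_segment[OF V(1) q(1), of 0] assms by auto
  have "q(0 := q 0 + \<epsilon> / 2) \<in> V \<inter> Rn k"
    using \<epsilon> q(2) assms(1) by (auto intro: fun_upd_Rn)
  then have "q(0 := q 0 + \<epsilon> / 2) = q" using V(2) by (simp add: q_def)
  then have "q 0 + \<epsilon> / 2 = q 0" by (metis fun_upd_same)
  then show False using \<epsilon>(1) by simp
qed

text \<open>Functions on \<open>\<real>\<^sup>d\<close> are total on sequences, and an inverse chosen on \<open>\<real>\<^sup>d\<close> is arbitrary elsewhere;
  differentiability does not see those values.\<close>

lemma Ck_on_Rn_cong:
  assumes "\<And>x. x \<in> Rn d \<Longrightarrow> f x = g x" "Ck_on d k (Rn d) f"
  shows "Ck_on d k (Rn d) g"
  using assms
proof (induction k arbitrary: f g)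
  case 0
  then show ?case unfolding Ck_on_0[OF order_refl] by (simp cong: continuous_on_cong)
next
  case (Suc k)
  have line: "(\<lambda>t. f (x(i := t))) = (\<lambda>t. g (x(i := t)))" if "x \<in> Rn d" "i < d" for x i
    using Suc.prems(1)[OF fun_upd_Rn[OF that]] by (rule ext)
  have "continuous_on (Rn d) f" using Ck_on_continuous[OF Suc.prems(2)] .
  then have "continuous_on (Rn d) g" using Suc.prems(1) by (simp cong: continuous_on_cong)
  then have "continuous_map (subtopology (Euclidean_space d) (Rn d)) euclideanreal g"
    using Ck_on_0[OF order_refl, of d g] by simp
  moreover have "Ck_on d k (Rn d) (partial i g)" if "i < d" for i
  proof (rule Suc.IH)
    show "Ck_on d k (Rn d) (partial i f)" using Suc.prems(2) that by simp
    show "partial i f x = partial i g x" if "x \<in> Rn d" for x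
      using line[OF that \<open>i < d\<close>] by (simp add: partial_def)
  qed
  moreover have "(\<lambda>t. g (x(i := t))) differentiable (at (x i))" if "x \<in> Rn d" "i < d" for x i
    using Suc.prems(2) that unfolding line[OF that, symmetric] Ck_on.simps by blast
  ultimately show ?case by simp
qed

lemma Rn_0: "Rn 0 = {\<lambda>_. 0}"
  by (auto simp: Rn_iff)

lemma origin_submanifold: "C1_submanifold d 0 {\<lambda>_. 0}"
  unfolding C1_submanifold_def
proof (intro conjI ballI)
  show "{\<lambda>_. 0} \<subseteq> Rn d" by (simp add: Rn_iff)
  fix p :: "nat \<Rightarrow> real" assume "p \<in> {\<lambda>_. 0}"
  then have p: "p \<in> Rn d" by (simp add: Rn_iff)
  have coord: "Ck_on d 1 (Rn d) (\<lambda>x. x j)" for j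
    using smooth_coordinate[of d 1 j] unfolding smooth_Rn_def mult_1 by blast
  have "C1_diffeo d (Rn d) (Rn d) (\<lambda>x. x)"
    unfolding C1_diffeo_def
  proof (intro conjI allI impI)
    show "bij_betw (\<lambda>x. x) (Rn d) (Rn d)" by (simp add: bij_betw_def)
    fix j
    show "Ck_on d 1 (Rn d) (\<lambda>x. x j)" by (rule coord)
    show "Ck_on d 1 (Rn d) (\<lambda>y. inv_into (Rn d) (\<lambda>x. x) y j)"
      by (rule Ck_on_Rn_cong[OF _ coord[of j]]) (metis f_inv_into_f image_ident)
  qed auto
  moreover have "(\<lambda>x. x) ` ({\<lambda>_. 0} \<inter> Rn d) = Rn d \<inter> Rn 0"
    unfolding Rn_0 by auto
  ultimately show "\<exists>U V \<Phi>. p \<in> U \<and> C1_diffeo d U V \<Phi> \<and> \<Phi> ` ({\<lambda>_. 0} \<inter> U) = V \<inter> Rn 0"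
    using p by blast
qed

lemma in_frontier_iff:
  "x \<in> Euclidean_space d frontier_of S \<longleftrightarrow> x \<in> Rn d \<and>
    (\<forall>T. openin (Euclidean_space d) T \<longrightarrow> x \<in> T \<longrightarrow> T \<inter> S \<noteq> {} \<and> \<not> T \<subseteq> S)"
  unfolding frontier_of_def interior_of_def Diff_iff in_closure_of by blast

lemma paraboloid_eq_0_iff: "1 \<le> d \<Longrightarrow> x \<in> Rn d \<Longrightarrow> paraboloid d x = 0 \<longleftrightarrow> x = (\<lambda>_. 0)"
  by (auto simp: paraboloid_def sum_nonneg_eq_0_iff Rn_iff fun_eq_iff) (metis lessThan_iff not_less)

lemma free_boundary_paraboloid:
  assumes "1 \<le> d" shows "free_boundary d (paraboloid d) = {\<lambda>_. 0}"
proof -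
  have "{x \<in> Rn d. paraboloid d x = 0 \<and> (\<forall>i<d. partial i (paraboloid d) x = 0)} = {\<lambda>_. 0}"
    using paraboloid_eq_0_iff[OF assms] by (auto simp: partial_paraboloid Rn_iff)
  moreover have "x \<in> Euclidean_space d frontier_of {\<lambda>_. 0} \<longleftrightarrow> x = (\<lambda>_. 0)" for x
  proof
    assume x: "x \<in> Euclidean_space d frontier_of {\<lambda>_. 0}"
    have "{\<lambda>_. 0 :: real} \<subseteq> Rn d" by (simp add: Rn_iff)
    then have "closedin (Euclidean_space d) {\<lambda>_. 0}"
      unfolding closedin_Euclidean_space_iff by auto
    then show "x = (\<lambda>_. 0)" using frontier_of_subset_closedin x by blast
  next
    assume x: "x = (\<lambda>_. 0)"
    show "x \<in> Euclidean_space d frontier_of {\<lambda>_. 0}"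
      unfolding in_frontier_iff
    proof (intro conjI allI impI)
      show "x \<in> Rn d" using x by (simp add: Rn_iff)
      fix T assume T: "openin (Euclidean_space d) T" "x \<in> T"
      then show "T \<inter> {\<lambda>_. 0} \<noteq> {}" using x by blast
      obtain \<epsilon> where \<epsilon>: "\<epsilon> > 0" "\<forall>t. \<bar>t\<bar> < \<epsilon> \<longrightarrow> x(0 := x 0 + t) \<in> T"
        using open_contains_line_segment[OF T, of 0] assms by auto
      then have "x(0 := x 0 + \<epsilon> / 2) \<in> T" by simp
      moreover have "x(0 := x 0 + \<epsilon> / 2) \<noteq> (\<lambda>_. 0)"
      proof
        assume "x(0 := x 0 + \<epsilon> / 2) = (\<lambda>_. 0)"
        then have "(x(0 := x 0 + \<epsilon> / 2)) 0 = 0" by simp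
        then show False using x \<epsilon>(1) by simp
      qed
      ultimately show "\<not> T \<subseteq> {\<lambda>_. 0}" by blast
    qed
  qed
  ultimately show ?thesis unfolding free_boundary_def by auto
qed

lemma has_singular_minimizer_ge_2:
  assumes "2 \<le> d" shows "has_singular_minimizer d"
  unfolding has_singular_minimizer_def
proof (rule exI[of _ "paraboloid d"], intro conjI)
  have "(\<lambda>_. 0)(0 := 1) \<in> Rn d" using assms by (auto simp: Rn_iff)
  moreover have "(\<lambda>_. 0 :: real)(0 := 1) \<noteq> (\<lambda>_. 0)" by (metis fun_upd_same zero_neq_one)
  ultimately show "\<exists>x\<in>Rn d. paraboloid d x \<noteq> 0"
    using paraboloid_eq_0_iff[of d] assms by (metis one_le_numeral order_trans)
  show "two_homogeneous d (paraboloid d)"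
    unfolding two_homogeneous_def paraboloid_def by (simp add: power_mult_distrib sum_distrib_left)
  show "global_minimizer d (paraboloid d)"
    using assms by (intro paraboloid_global_minimizer) simp
  have "C1_representative d (paraboloid d) (paraboloid d)"
    using smooth_paraboloid[of d] unfolding C1_representative_def smooth_Rn_def by blast
  moreover have "\<not> C1_submanifold d (d - 1) (free_boundary d (paraboloid d))"
    using assms singleton_not_submanifold[of "d - 1" d] by (simp add: free_boundary_paraboloid)
  ultimately show "\<exists>z'. C1_representative d (paraboloid d) z' \<and> \<not> C1_submanifold d (d - 1) (free_boundary d z')"
    by blast
qed

text \<open>On each open half-line \<open>z\<close> is a multiple of \<open>s\<^sup>2\<close>, and as \<open>z'\<close> is continuous and open sets
  are not null, so is \<open>z'\<close>. At the origin \<open>z'\<close> and its derivative vanish as one-sided limits. As the two factors are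
  not both zero, the contact set is neither the whole line nor does it have a boundary point apart from the origin.\<close>

lemma free_boundary_dimension_1:
  assumes nontrivial: "x0 \<in> Rn 1" "z x0 \<noteq> 0" and hom: "two_homogeneous 1 z"
    and rep: "C1_representative 1 z z'"
  shows "free_boundary 1 z' = {\<lambda>_. 0}"
proof -
  define e where "e = (\<lambda>s. (\<lambda>_::nat. 0::real)(0 := s))"
  have e_Rn: "e s \<in> Rn 1" for s by (auto simp: e_def Rn_iff)
  have Rn_e: "x = e (x 0)" if "x \<in> Rn 1" for x
    using that by (auto simp: e_def Rn_iff fun_eq_iff)
  have e_0: "e s 0 = s" for s by (simp add: e_def)
  have C1: "Ck_on 1 1 (Rn 1) z'" and ae: "AE x in leb 1. z' x = z x"
    using rep unfolding C1_representative_def by blast+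
  define g where "g = (\<lambda>s. z' (e s))"
  define g' where "g' = (\<lambda>s. partial 0 z' (e s))"
  have "has_partial 1 0 z' (partial 0 z')"
    using Ck_on_has_partial[of 1 0 z' 0] C1 by simp
  then have g_deriv: "(g has_real_derivative g' s) (at s)" for s
    using e_Rn[of 0] unfolding has_partial_def g_def g'_def e_def by fastforce
  have g_cont: "isCont g s" for s by (rule DERIV_isCont[OF g_deriv])
  \<comment> \<open>The factor in front of \<open>s\<^sup>2\<close>, which depends on the sign of \<open>s\<close> only.\<close>
  define c where "c = (\<lambda>s::real. z (e (sgn s)))"
  have z_e: "z (e s) = c s * s\<^sup>2" if "s \<noteq> 0" for s
  proof -
    have "(\<lambda>i. \<bar>s\<bar> * e (sgn s) i) = e s"
      by (auto simp: e_def fun_eq_iff abs_mult_sgn)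
    moreover have "z (\<lambda>i. \<bar>s\<bar> * e (sgn s) i) = \<bar>s\<bar>\<^sup>2 * z (e (sgn s))"
      using hom e_Rn that unfolding two_homogeneous_def by (metis zero_less_abs_iff)
    ultimately show ?thesis by (simp add: c_def)
  qed
  have z_0: "z (e 0) = 0"
  proof -
    have "z (\<lambda>i. 2 * e 0 i) = 2\<^sup>2 * z (e 0)"
      using hom e_Rn[of 0] unfolding two_homogeneous_def by (metis zero_less_numeral)
    moreover have "(\<lambda>i. 2 * e 0 i) = e 0" by (auto simp: e_def)
    ultimately show ?thesis by simp
  qed
  have c_const: "c s = c t" if "s * t > 0" for s t
  proof -
    have "sgn s = sgn t" using that by (auto simp: zero_less_mult_iff sgn_if)
    then show ?thesis by (simp add: c_def)
  qed
  have g_eq: "g s = c s * s\<^sup>2" if s: "s \<noteq> 0" for s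
  proof (rule ccontr)
    assume neq: "g s \<noteq> c s * s\<^sup>2"
    \<comment> \<open>Were the claim false, it would fail on an open set, where \<open>z'\<close> and \<open>z\<close> agree somewhere.\<close>
    define W where "W = {t. t * s > 0} \<inter> {t. g t \<noteq> c s * t\<^sup>2}"
    have "open W" unfolding W_def
      by (intro open_Int open_Collect_less open_Collect_neq continuous_intros continuous_at_imp_continuous_on ballI g_cont)
    then have "open ((\<lambda>x::nat \<Rightarrow> real. x 0) -` W)"
      by (rule open_vimage) (rule continuous_on_product_coordinates)
    then have "openin (Euclidean_space 1) (Rn 1 \<inter> (\<lambda>x. x 0) -` W)"
      unfolding openin_Euclidean by blast
    moreover have "0 < s * s" using s by (metis not_real_square_gt_zero)
    then have "e s \<in> Rn 1 \<inter> (\<lambda>x. x 0) -` W"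
      using neq e_Rn by (simp add: W_def e_0)
    ultimately obtain y where y: "y \<in> Rn 1 \<inter> (\<lambda>x. x 0) -` W" "z' y = z y"
      using open_not_null[OF _ _ ae] by blast
    define t where "t = y 0"
    have t: "y = e t" "t * s > 0" "g t \<noteq> c s * t\<^sup>2"
      using y(1) Rn_e[of y] by (auto simp: W_def t_def)
    have "t \<noteq> 0" using t(2) by auto
    then have "g t = c t * t\<^sup>2" using y(2) z_e[of t] t(1) by (simp add: g_def)
    then show False using t(3) c_const[OF t(2)] by simp
  qed
  have lim: "((\<lambda>s. c s * s) \<longlongrightarrow> 0) (at_right 0)" "((\<lambda>s. c s * s\<^sup>2) \<longlongrightarrow> 0) (at_right 0)"
  proof -
    have c1: "c 1 = c s" if "s > 0" for s using c_const[of 1 s] that by simp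
    have "((\<lambda>s. c 1 * s) \<longlongrightarrow> c 1 * 0) (at_right 0)" by (intro tendsto_intros)
    moreover have "eventually (\<lambda>s. c 1 * s = c s * s) (at_right 0)"
      unfolding eventually_at_filter by (intro always_eventually allI impI) (simp add: c1)
    ultimately show "((\<lambda>s. c s * s) \<longlongrightarrow> 0) (at_right 0)"
      using Lim_transform_eventually by force
    have "((\<lambda>s. c 1 * s\<^sup>2) \<longlongrightarrow> c 1 * 0\<^sup>2) (at_right 0)" by (intro tendsto_intros)
    moreover have "eventually (\<lambda>s. c 1 * s\<^sup>2 = c s * s\<^sup>2) (at_right 0)"
      unfolding eventually_at_filter by (intro always_eventually allI impI) (simp add: c1)
    ultimately show "((\<lambda>s. c s * s\<^sup>2) \<longlongrightarrow> 0) (at_right 0)"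
      using Lim_transform_eventually by force
  qed
  have g_0: "g 0 = 0"
  proof (rule tendsto_unique[OF trivial_limit_at_right_real])
    show "(g \<longlongrightarrow> g 0) (at_right 0)"
      using g_cont[of 0] by (simp add: isCont_def filterlim_at_split)
    have "eventually (\<lambda>s. c s * s\<^sup>2 = g s) (at_right 0)"
      unfolding eventually_at_filter by (intro always_eventually allI impI) (simp add: g_eq)
    then show "(g \<longlongrightarrow> 0) (at_right 0)" by (rule Lim_transform_eventually[OF lim(2)])
  qed
  have g'_0: "g' 0 = 0"
  proof (rule tendsto_unique[OF trivial_limit_at_right_real])
    have "((\<lambda>h. (g (0 + h) - g 0) / h) \<longlongrightarrow> g' 0) (at 0)"
      using g_deriv[of 0] unfolding DERIV_def .
    then show "((\<lambda>h. g h / h) \<longlongrightarrow> g' 0) (at_right 0)"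
      using g_0 by (simp add: filterlim_at_split)
    have "eventually (\<lambda>s. c s * s = g s / s) (at_right 0)"
      unfolding eventually_at_filter by (intro always_eventually allI impI) (simp add: g_eq power2_eq_square)
    then show "((\<lambda>h. g h / h) \<longlongrightarrow> 0) (at_right 0)" by (rule Lim_transform_eventually[OF lim(1)])
  qed
  define S where "S = {x \<in> Rn 1. z' x = 0 \<and> (\<forall>i<1. partial i z' x = 0)}"
  have S_e: "e s \<in> S \<longleftrightarrow> g s = 0 \<and> g' s = 0" for s
    using e_Rn by (auto simp: S_def g_def g'_def)
  have S_ne: "e s \<in> S \<longleftrightarrow> c s = 0" if s: "s \<noteq> 0" for s
  proof
    assume "c s = 0"
    have "g t = 0" if "t \<in> {t. 0 < t * s}" for t
    proof -
      have "t \<noteq> 0" "c t = c s" using that c_const[of t s] by auto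
      then show ?thesis using g_eq[of t] \<open>c s = 0\<close> by simp
    qed
    moreover have "open {t. 0 < t * s}" by (intro open_Collect_less continuous_intros)
    moreover have "((\<lambda>_. 0) has_real_derivative 0) (at s)" by simp
    moreover have "s \<in> {t. 0 < t * s}" using s by (simp add: zero_less_mult_iff) linarith
    ultimately have "(g has_real_derivative 0) (at s)"
      by (metis has_field_derivative_transform_within_open)
    then show "e s \<in> S" unfolding S_e using g_deriv[of s] DERIV_unique g_eq[OF s] \<open>c s = 0\<close> by auto
  qed (use s g_eq[OF s] in \<open>auto simp: S_e\<close>)
  have nonzero: "c 1 \<noteq> 0 \<or> c (- 1) \<noteq> 0"
  proof -
    define s where "s = x0 0"
    have z_s: "z (e s) \<noteq> 0" using nontrivial Rn_e[of x0] by (simp add: s_def)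
    then have s: "s \<noteq> 0" using z_0 by metis
    then have "c s \<noteq> 0" using z_s z_e[OF s] by auto
    with s show ?thesis using c_const[of s 1] c_const[of s "- 1"] by (cases "s > 0") auto
  qed
  have "x \<in> Euclidean_space 1 frontier_of S \<longleftrightarrow> x = e 0" for x
  proof
    assume x: "x \<in> Euclidean_space 1 frontier_of S"
    show "x = e 0"
    proof (rule ccontr)
      assume "x \<noteq> e 0"
      define s where "s = x 0"
      have "x \<in> Rn 1" using x unfolding in_frontier_iff by blast
      then have s: "x = e s" "s \<noteq> 0" using \<open>x \<noteq> e 0\<close> Rn_e[of x] by (auto simp: s_def)
      define T where "T = Rn 1 \<inter> {y. 0 < y 0 * s}"
      have "open {y :: nat \<Rightarrow> real. 0 < y 0 * s}"
        by (intro open_Collect_less continuous_intros continuous_on_product_coordinates)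
      then have "openin (Euclidean_space 1) T" unfolding openin_Euclidean T_def by blast
      moreover have "x \<in> T" using s e_Rn by (simp add: T_def e_0 zero_less_mult_iff) linarith
      ultimately have T: "T \<inter> S \<noteq> {}" "\<not> T \<subseteq> S" using x unfolding in_frontier_iff by blast+
      have "y \<in> S \<longleftrightarrow> c s = 0" if "y \<in> T" for y
      proof -
        have "y = e (y 0)" "y 0 \<noteq> 0" "c (y 0) = c s"
          using that Rn_e[of y] c_const[of "y 0" s] by (auto simp: T_def)
        then show ?thesis using S_ne[of "y 0"] by metis
      qed
      then show False using T by blast
    qed
  next
    assume x: "x = e 0"
    show "x \<in> Euclidean_space 1 frontier_of S"
      unfolding in_frontier_iff
    proof (intro conjI allI impI)
      show "x \<in> Rn 1" using x e_Rn by simp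
      fix T assume T: "openin (Euclidean_space 1) T" "x \<in> T"
      have "e 0 \<in> S" using S_e g_0 g'_0 by simp
      then show "T \<inter> S \<noteq> {}" using T(2) x by blast
      obtain \<epsilon> where \<epsilon>: "\<epsilon> > 0" "\<forall>t. \<bar>t\<bar> < \<epsilon> \<longrightarrow> x(0 := x 0 + t) \<in> T"
        using open_contains_line_segment[OF T, of 0] by auto
      have "x(0 := x 0 + t) = e t" for t using x by (simp add: e_def)
      then have in_T: "e t \<in> T" if "\<bar>t\<bar> < \<epsilon>" for t
        using \<epsilon>(2) that by metis
      have "e (\<epsilon> / 2) \<in> T" "e (- \<epsilon> / 2) \<in> T"
        by (rule in_T, use \<epsilon>(1) in simp)+
      moreover have "c (\<epsilon> / 2) = c 1" "c (- \<epsilon> / 2) = c (- 1)"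
        using \<epsilon>(1) by (auto intro!: c_const)
      ultimately show "\<not> T \<subseteq> S"
        using nonzero S_ne[of "\<epsilon> / 2"] S_ne[of "- \<epsilon> / 2"] \<epsilon>(1) by auto
    qed
  qed
  moreover have "e 0 = (\<lambda>_. 0)" by (auto simp: e_def)
  ultimately show ?thesis unfolding free_boundary_def S_def by auto
qed

lemma not_has_singular_minimizer_1: "\<not> has_singular_minimizer 1"
proof
  assume "has_singular_minimizer 1"
  then obtain z x z' where "x \<in> Rn 1" "z x \<noteq> 0" "two_homogeneous 1 z" "C1_representative 1 z z'"
    "\<not> C1_submanifold 1 (1 - 1) (free_boundary 1 z')"
    unfolding has_singular_minimizer_def by blast
  then show False
    using free_boundary_dimension_1[of x z z'] origin_submanifold[of 1] by simp
qed

theorem corollary2: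
  shows "(\<exists>d\<ge>1. has_singular_minimizer d) \<and> critical_dimension = 2"
proof
  have two: "has_singular_minimizer 2" by (rule has_singular_minimizer_ge_2) simp
  then show "\<exists>d\<ge>1. has_singular_minimizer d" by (intro exI[of _ 2]) simp
  show "critical_dimension = 2"
    unfolding critical_dimension_def
  proof (rule Least_equality)
    show "1 \<le> (2::nat) \<and> has_singular_minimizer 2" using two by simp
    fix d :: nat assume d: "1 \<le> d \<and> has_singular_minimizer d"
    then have "d \<noteq> 1" using not_has_singular_minimizer_1 by auto
    then show "2 \<le> d" using d by simp
  qed
qed

end
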